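(* Let $0<\alpha<1$ and $\theta^2\le\varepsilon^2$. Let $0=t_0<t_1<\cdots<t_M=T$ be a time mesh with $\tau_n=t_n-t_{n-1}$, and let $(\phi^n,R^n)$ satisfy, for $n=0,1,\dots,M-1$, the L1-CN scheme $$\widetilde L_l^\alpha\phi^{n+\frac12}-\varepsilon^2\frac{\Delta(\phi^{n+1}+\phi^n)}{2}+\Big(1-\frac{R^{n+1}+R^n}{2R^{n+\frac12}}\Big)\theta^2\Delta\phi^{n+\frac12}+\frac{R^{n+1}+R^n}{2R^{n+\frac12}}\Big(F'(\phi^{n+\frac12})+\widetilde L_h^\alpha\phi^{n+\frac12}\Big)=0,$$ $$\frac{R^{n+1}-R^n}{\tau_{n+1}}=\frac{1}{2R^{n+\frac12}}\Big(-\theta^2\Delta\phi^{n+\frac12}+F'(\phi^{n+\frac12})+\widetilde L_h^\alpha\phi^{n+\frac12},\ \frac{\phi^{n+1}-\phi^n}{\tau_{n+1}}\Big),$$ where $\phi^{n+\frac12}:=\phi^n+\frac{\tau_{n+1}}{2\tau_n}(\phi^n-\phi^{n-1})$ and $R^{n+\frac12}:=R^n+\frac{\tau_{n+1}}{2\tau_n}(R^n-R^{n-1})$, with periodic or Neumann boundary conditions on the $\phi^n$. Then for $n=0,1,\dots,M-1$, $$\frac{\varepsilon^2-\theta^2}{2}\|\nabla\phi^{n+1}\|_0^2+\frac{\theta^2}{4}\|\nabla(\phi^{n+1}-\phi^n)\|_0^2+|R^{n+1}|^2-\Big[\frac{\varepsilon^2-\theta^2}{2}\|\nabla\phi^n\|_0^2+\frac{\theta^2}{4}\Big(\frac{\tau_{n+1}}{\tau_n}\Big)^2\|\nabla(\phi^n-\phi^{n-1})\|_0^2+|R^n|^2\Big]\le0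 .$$ Consequently the scheme is unconditionally stable in each of the following two cases: (i) if the mesh is uniform, i.e. $\tau_{n+1}/\tau_n=1$ for all $n$, then the discrete energy $\frac{\varepsilon^2-\theta^2}{2}\|\nabla\phi^{n+1}\|_0^2+\frac{\theta^2}{4}\|\nabla(\phi^{n+1}-\phi^n)\|_0^2+|R^{n+1}|^2$ is non-increasing in $n$; (ii) if $\theta=0$ (arbitrary mesh), then the energy $\widetilde E_\varepsilon^{n+1}:=\frac{\varepsilon^2}{2}\|\nabla\phi^{n+1}\|_0^2+|R^{n+1}|^2$ is non-increasing in $n$.
   Context: The scheme is a time discretization (continuous in space) of the time fractional Allen–Cahn equation ${}_0D_t^\alpha\phi=\varepsilon^2\Delta\phi-F'(\phi)$ on a bounded domain $\Omega\subset\mathbb{R}^d$, $d\in\{1,2,3\}$, with periodic boundary conditions ($\Omega$ a box) or homogeneous Neumann boundary conditions, where $F:\mathbb{R}\to\mathbb{R}$ is a (differentiable) nonlinear potential and $\varepsilon,\theta$ are real constants. $(\cdot,\cdot)$ and $\|\cdot\|_0$ denote the $L^2(\Omega)$ inner product and norm. Each $\phi^n$ is a real-valued function on $\Omega$ satisfying the boundary condition, regular enough (e.g. $\phi^n\in H^2(\Omega)$, $F'(\phi^{n+\frac12})\in L^2(\Omega)$) for the scheme to hold in $L^2(\Omega)$ and for Green's formula $-(\Delta u,v)=(\nabla u,\nabla v)$ to apply without boundary terms; each $R^n$ is a real number (an auxiliary scalar variable), with $R^{n+\frac12}\neq0$. For $n=0$ the quantities $\phi^{-1}$, $R^{-1}$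 and $\tau_0>0$ entering the extrapolations are arbitrary prescribed starting data ($\tau_0=\tau_1$ on a uniform mesh); $\phi^{-1}$ has the same regularity and boundary conditions as the other iterates. For each $n$, with $t_{n+\frac12}=\frac{t_n+t_{n+1}}2$, the L1-CN difference operators are $$\widetilde L_l^\alpha\phi^{n+\frac12}=\widetilde b_0\frac{\phi^{n+1}-\phi^n}{\tau_{n+1}},\qquad \widetilde L_h^\alpha\phi^{n+\frac12}=\sum_{k=0}^{n-1}\widetilde b_{n-k}\frac{\phi^{k+1}-\phi^k}{\tau_{k+1}}$$ (the empty sum for $n=0$ is $0$), with coefficients, depending on $n$, $$\widetilde b_0=\frac{\tau_{n+1}^{1-\alpha}}{\Gamma(2-\alpha)2^{1-\alpha}},\qquad \widetilde b_{n-k}=\frac{1}{\Gamma(1-\alpha)}\int_{t_k}^{t_{k+1}}(t_{n+\frac12}-s)^{-\alpha}\,ds,\quad k=0,\dots,n-1 .$$ *)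

theory Defs
  imports "HOL-Analysis.Analysis"
begin

primrec Ck :: "nat \<Rightarrow> ('a::euclidean_space \<Rightarrow> real) \<Rightarrow> bool" where
  "Ck 0 f \<longleftrightarrow> continuous_on UNIV f"
| "Ck (Suc k) f \<longleftrightarrow> (\<forall>x. f differentiable (at x)) \<and>
     (\<forall>i\<in>Basis. Ck k (\<lambda>x. frechet_derivative f (at x) i))"

definition smooth :: "('a::euclidean_space \<Rightarrow> real) \<Rightarrow> bool" where
  "smooth f \<longleftrightarrow> (\<forall>k. Ck k f)"

definition compactly_supported_in :: "'a::euclidean_space set \<Rightarrow> ('a \<Rightarrow> real) \<Rightarrow> bool" where
  "compactly_supported_in \<Omega> \<psi> \<longleftrightarrow>
     compact (closure {x. \<psi> x \<noteq> 0}) \<and> closure {x. \<psi> x \<noteq> 0} \<subseteq> \<Omega>"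

definition box_periodic :: "'a::euclidean_space \<Rightarrow> 'a \<Rightarrow> ('a \<Rightarrow> real) \<Rightarrow> bool" where
  "box_periodic a b \<psi> \<longleftrightarrow> (\<forall>x. \<forall>i\<in>Basis. \<psi> (x + ((b - a) \<bullet> i) *\<^sub>R i) = \<psi> x)"

definition L2 :: "'a::euclidean_space set \<Rightarrow> ('a \<Rightarrow> real) set" where
  "L2 \<Omega> = {u. u \<in> borel_measurable (lebesgue_on \<Omega>) \<and>
              integrable (lebesgue_on \<Omega>) (\<lambda>x. (u x)\<^sup>2)}"

definition l2_inner ::
    "'a::euclidean_space set \<Rightarrow> ('a \<Rightarrow> 'b::real_inner) \<Rightarrow> ('a \<Rightarrow> 'b) \<Rightarrow> real" where
  "l2_inner \<Omega> u v = (LINT x|lebesgue_on \<Omega>. u x \<bullet> v x)"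

definition l2_norm :: "'a::euclidean_space set \<Rightarrow> ('a \<Rightarrow> 'b::real_inner) \<Rightarrow> real" where
  "l2_norm \<Omega> u = sqrt (l2_inner \<Omega> u u)"

definition has_weak_partial ::
    "'a::euclidean_space set \<Rightarrow> 'a \<Rightarrow> ('a \<Rightarrow> real) \<Rightarrow> ('a \<Rightarrow> real) \<Rightarrow> bool" where
  "has_weak_partial \<Omega> i u g \<longleftrightarrow> u \<in> L2 \<Omega> \<and> g \<in> L2 \<Omega> \<and>
     (\<forall>\<psi>. smooth \<psi> \<and> compactly_supported_in \<Omega> \<psi> \<longrightarrow>
        l2_inner \<Omega> u (\<lambda>x. frechet_derivative \<psi> (at x) i) = - l2_inner \<Omega> g \<psi>)"

(* Weak partial derivatives are determined only almost everywhere; an arbitrary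
   representative is chosen, and every use below is insensitive to null sets. *)
definition weak_partial ::
    "'a::euclidean_space set \<Rightarrow> 'a \<Rightarrow> ('a \<Rightarrow> real) \<Rightarrow> 'a \<Rightarrow> real" where
  "weak_partial \<Omega> i u = (SOME g. has_weak_partial \<Omega> i u g)"

definition H1 :: "'a::euclidean_space set \<Rightarrow> ('a \<Rightarrow> real) set" where
  "H1 \<Omega> = {u \<in> L2 \<Omega>. \<forall>i\<in>Basis. \<exists>g. has_weak_partial \<Omega> i u g}"

definition H2 :: "'a::euclidean_space set \<Rightarrow> ('a \<Rightarrow> real) set" where
  "H2 \<Omega> = {u \<in> H1 \<Omega>. \<forall>i\<in>Basis. weak_partial \<Omega> i u \<in> H1 \<Omega>}"

definition weak_grad :: "'a::euclidean_space set \<Rightarrow> ('a \<Rightarrow> real) \<Rightarrow> 'a \<Rightarrow> 'a" where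
  "weak_grad \<Omega> u x = (\<Sum>i\<in>Basis. weak_partial \<Omega> i u x *\<^sub>R i)"

definition weak_laplacian :: "'a::euclidean_space set \<Rightarrow> ('a \<Rightarrow> real) \<Rightarrow> 'a \<Rightarrow> real" where
  "weak_laplacian \<Omega> u x = (\<Sum>i\<in>Basis. weak_partial \<Omega> i (weak_partial \<Omega> i u) x)"

(* Homogeneous Neumann condition: the generalised normal derivative of u, i.e. the functional
   v |-> (laplacian u, v) + (grad u, grad v) on H^1, vanishes.  No regularity of the boundary
   of the domain is needed for this formulation. *)
definition neumann_bc :: "'a::euclidean_space set \<Rightarrow> ('a \<Rightarrow> real) \<Rightarrow> bool" where
  "neumann_bc \<Omega> u \<longleftrightarrow> (\<forall>v\<in>H1 \<Omega>.
     l2_inner \<Omega> (weak_laplacian \<Omega> u) v = - l2_inner \<Omega> (weak_grad \<Omega> u) (weak_grad \<Omega> v))"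

(* For w in H^1 of a box and a smooth periodic psi, integrating w * d_i psi by parts leaves the
   integral of (jump of the trace of w between the two faces orthogonal to i) * psi.  Hence
   w has equal traces on opposite faces iff no boundary term appears for any such psi. *)
definition periodic_traces :: "'a::euclidean_space \<Rightarrow> 'a \<Rightarrow> ('a \<Rightarrow> real) \<Rightarrow> bool" where
  "periodic_traces a b w \<longleftrightarrow> (\<forall>\<psi>. \<forall>i\<in>Basis. smooth \<psi> \<and> box_periodic a b \<psi> \<longrightarrow>
     l2_inner (box a b) w (\<lambda>x. frechet_derivative \<psi> (at x) i)
       = - l2_inner (box a b) (weak_partial (box a b) i w) \<psi>)"

definition periodic_bc :: "'a::euclidean_space \<Rightarrow> 'a \<Rightarrow> ('a \<Rightarrow> real) \<Rightarrow> bool" where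
  "periodic_bc a b u \<longleftrightarrow> periodic_traces a b u \<and>
     (\<forall>j\<in>Basis. periodic_traces a b (weak_partial (box a b) j u))"

(* Time levels are indexed by int because the scheme starts from data at level -1. *)

definition extrapolate :: "(int \<Rightarrow> real) \<Rightarrow> (int \<Rightarrow> real) \<Rightarrow> int \<Rightarrow> real" where
  "extrapolate \<tau> r n = r n + \<tau> (n + 1) / (2 * \<tau> n) * (r n - r (n - 1))"

definition extrapolate_fun ::
    "(int \<Rightarrow> real) \<Rightarrow> (int \<Rightarrow> 'a \<Rightarrow> real) \<Rightarrow> int \<Rightarrow> 'a \<Rightarrow> real" where
  "extrapolate_fun \<tau> \<phi> n x = extrapolate \<tau> (\<lambda>k. \<phi> k x) n"

(* L1CN_coeff \<alpha> t n j is the coefficient b_j of the step from t_n to t_(n+1); for 1 \<le> j \<le> n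
   the integral runs over the mesh interval [t_k, t_(k+1)] with k = n - j. *)
definition L1CN_coeff :: "real \<Rightarrow> (int \<Rightarrow> real) \<Rightarrow> int \<Rightarrow> int \<Rightarrow> real" where
  "L1CN_coeff \<alpha> t n j =
     (if j = 0 then (t (n + 1) - t n) powr (1 - \<alpha>) / (Gamma (2 - \<alpha>) * 2 powr (1 - \<alpha>))
      else 1 / Gamma (1 - \<alpha>) *
        integral {t (n - j)..t (n - j + 1)} (\<lambda>s. ((t n + t (n + 1)) / 2 - s) powr (- \<alpha>)))"

definition L1CN_local ::
    "real \<Rightarrow> (int \<Rightarrow> real) \<Rightarrow> (int \<Rightarrow> real) \<Rightarrow> (int \<Rightarrow> 'a \<Rightarrow> real) \<Rightarrow> int \<Rightarrow> 'a \<Rightarrow> real" where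
  "L1CN_local \<alpha> t \<tau> \<phi> n x = L1CN_coeff \<alpha> t n 0 * ((\<phi> (n + 1) x - \<phi> n x) / \<tau> (n + 1))"

definition L1CN_history ::
    "real \<Rightarrow> (int \<Rightarrow> real) \<Rightarrow> (int \<Rightarrow> real) \<Rightarrow> (int \<Rightarrow> 'a \<Rightarrow> real) \<Rightarrow> int \<Rightarrow> 'a \<Rightarrow> real" where
  "L1CN_history \<alpha> t \<tau> \<phi> n x =
     (\<Sum>k\<in>{0..<n}. L1CN_coeff \<alpha> t n (n - k) * ((\<phi> (k + 1) x - \<phi> k x) / \<tau> (k + 1)))"

end

theory Submission
  imports Defs
begin

text \<open>
The estimate is an energy identity. Take the inner product of the equation for the phase variable with the increment
\<open>\<phi> (n + 1) - \<phi> n\<close> and multiply the equation for the auxiliary variable by \<open>R (n + 1) + R n\<close>. The scheme is built so that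
the nonlinear term and the history term then occur in both equations with the same factor, and they cancel. What remains
is the local part of the fractional derivative, whose coefficient is non-negative, and inner products of Laplacians
with increments. Green's formula makes these inner products of gradients, and they combine into differences of squares
and one complete square, the squared norm of the gradient of
\<open>(\<phi> (n + 1) - \<phi> n) - (\<tau> (n + 1) / \<tau> n) * (\<phi> n - \<phi> (n - 1))\<close>. This is \<open>scheme_energy_step\<close>; monotonicity in the two
special cases is the iteration of the one-step estimates.

Two facts of analysis carry this computation. Weak derivatives are fixed representatives chosen for each function
separately, so linearity of gradient and Laplacian holds only almost everywhere, and it rests on the uniqueness of weak
derivatives, that is, on the fundamental lemma of the calculus of variations (\<open>AE_zero_of_bump_integrals\<close>). It is proved
with bumps made of products of \<open>exp (- 1 / s)\<close>.

Green's formula is the definition of the Neumann condition. Under periodic boundary conditions the definition provides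
integration by parts only against smooth periodic functions, and it has to be extended to pairs of functions with
periodic traces (\<open>periodic_integration_by_parts\<close>). The extension uses translations. On the periodic cell, a
function with a weak derivative changes under translation by the integral of the translated derivative. So it moves
in a Lipschitz way, and differentiating the translation invariant inner product of two such functions at zero
translation gives the product rule (\<open>translation_derivative_skew\<close>).
\<close>

section \<open>Smooth functions and bumps\<close>

lemma Ck_SucD: "Ck (Suc k) f \<Longrightarrow> Ck k f"
proof (induction k arbitrary: f)
  case 0
  then show ?case
    by (auto simp: continuous_at_imp_continuous_on differentiable_imp_continuous_within)
next
  case (Suc k)
  then show ?case by (metis Ck.simps(2))
qed

lemma Ck_const: "Ck k (\<lambda>x. c)"
  by (induction k arbitrary: c) auto

lemma Ck_add:
  assumes "Ck k f" "Ck k g" shows "Ck k (\<lambda>x. f x + g x)"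
  using assms
proof (induction k arbitrary: f g)
  case 0
  then show ?case by (auto intro: continuous_on_add)
next
  case (Suc k)
  have "frechet_derivative (\<lambda>x. f x + g x) (at x)
      = (\<lambda>h. frechet_derivative f (at x) h + frechet_derivative g (at x) h)" for x
    using Suc.prems
    by (intro frechet_derivative_at[symmetric] has_derivative_add) (auto simp: frechet_derivative_works)
  with Suc show ?case by auto
qed

lemma Ck_mult:
  assumes "Ck k f" "Ck k g" shows "Ck k (\<lambda>x. f x * g x)"
  using assms
proof (induction k arbitrary: f g)
  case 0
  then show ?case by (auto intro: continuous_on_mult)
next
  case (Suc k)
  have "frechet_derivative (\<lambda>x. f x * g x) (at x)
      = (\<lambda>h. f x * frechet_derivative g (at x) h + frechet_derivative f (at x) h * g x)" for x
    using Suc.prems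
    by (intro frechet_derivative_at[symmetric] has_derivative_mult) (auto simp: frechet_derivative_works)
  with Suc Ck_SucD[OF Suc.prems(1)] Ck_SucD[OF Suc.prems(2)] show ?case
    by (auto intro!: Ck_add)
qed

lemma smooth_const: "smooth (\<lambda>x. c)"
  and smooth_add: "smooth f \<Longrightarrow> smooth g \<Longrightarrow> smooth (\<lambda>x. f x + g x)"
  and smooth_mult: "smooth f \<Longrightarrow> smooth g \<Longrightarrow> smooth (\<lambda>x. f x * g x)"
  by (auto simp: smooth_def intro: Ck_const Ck_add Ck_mult)

lemma smooth_prod:
  assumes "\<And>j. j \<in> J \<Longrightarrow> smooth (f j)"
  shows "smooth (\<lambda>x. \<Prod>j\<in>J. f j x)"
  using assms by (induction J rule: infinite_finite_induct) (auto intro: smooth_const smooth_mult)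

lemma smooth_differentiable: "smooth f \<Longrightarrow> f differentiable (at x)"
  by (metis smooth_def Ck.simps(2))

lemma smooth_continuous_on: "smooth f \<Longrightarrow> continuous_on S f"
  by (metis smooth_def Ck.simps(1) continuous_on_subset subset_UNIV)

lemma smooth_frechet: "smooth f \<Longrightarrow> i \<in> Basis \<Longrightarrow> smooth (\<lambda>x. frechet_derivative f (at x) i)"
  by (metis smooth_def Ck.simps(2))

lemma smooth_affine:
  fixes l :: "'a::euclidean_space"
  shows "smooth (\<lambda>x. l \<bullet> x + c)"
proof -
  have "frechet_derivative (\<lambda>x. l \<bullet> x + c) (at x) = (\<lambda>h. l \<bullet> h)" for x
    by (rule frechet_derivative_at[symmetric]) (auto intro!: derivative_eq_intros)
  then have "Ck k (\<lambda>x. l \<bullet> x + c)" for k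
    by (cases k) (auto intro!: Ck_const continuous_intros derivative_intros)
  then show ?thesis by (simp add: smooth_def)
qed

text \<open>The phase \<open>c\<close> is arbitrary so that the derivative, a cosine shifted by a quarter period, is covered
by the induction hypothesis.\<close>

lemma smooth_cos_affine:
  fixes l :: "'a::euclidean_space"
  shows "smooth (\<lambda>x. cos (l \<bullet> x + c))"
proof -
  have D: "((\<lambda>x. cos (l \<bullet> x + c)) has_derivative (\<lambda>h. (l \<bullet> h) * cos (l \<bullet> x + (c + pi / 2)))) (at x)"
    for x c
    by (auto intro!: derivative_eq_intros simp: cos_add sin_add cos_diff sin_diff algebra_simps)
  have "Ck k (\<lambda>x. cos (l \<bullet> x + c))" for k
  proof (induction k arbitrary: c)
    case 0
    then show ?case by (auto intro!: continuous_intros)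
  next
    case (Suc k)
    then show ?case using D
      by (auto simp: frechet_derivative_at[OF D, symmetric] differentiable_def intro!: Ck_mult Ck_const)
  qed
  then show ?thesis by (simp add: smooth_def)
qed

text \<open>The derivative of \<open>exp (- 1 / s)\<close> brings down powers of \<open>1 / s\<close>. The family with an arbitrary power in front is
closed under differentiation up to linear combinations, so smoothness follows by one induction.\<close>

definition flat :: "nat \<Rightarrow> real \<Rightarrow> real" where
  "flat k s = (if s > 0 then (1 / s) ^ k * exp (- 1 / s) else 0)"

text \<open>All orders \<open>k\<close> are needed at once: the difference quotient of \<open>flat k\<close> at the origin is \<open>flat (k + 1)\<close>,
and it tends to zero because the exponential beats every power.\<close>

lemma flat_tendsto_0: "(flat k \<longlongrightarrow> 0) (at 0)"
proof -
  have "((\<lambda>s. (1 / s) ^ k / exp (1 / s)) \<longlongrightarrow> (0::real)) (at_right 0)"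
    using filterlim_compose[OF tendsto_power_div_exp_0 filterlim_inverse_at_top_right]
    by (simp add: divide_inverse)
  then have "(flat k \<longlongrightarrow> 0) (at_right 0)"
    by (rule Lim_transform_eventually)
      (auto simp: flat_def exp_minus field_simps eventually_at_right_less intro!: eventually_mono[OF eventually_at_right_less])
  moreover have "(flat k \<longlongrightarrow> 0) (at_left 0)"
    by (rule tendsto_eventually) (auto simp: flat_def eventually_at_filter)
  ultimately show ?thesis by (simp add: filterlim_split_at)
qed

lemma flat_has_derivative:
  "(flat k has_real_derivative (flat (k + 2) s - k * flat (k + 1) s)) (at s)"
proof (cases s "0::real" rule: linorder_cases)
  case less
  have "((\<lambda>s. 0) has_real_derivative 0) (at s)" by simp
  then have "(flat k has_real_derivative 0) (at s)"
    by (rule has_field_derivative_transform_within_open[where S = "{..<0}"]) (use less in \<open>auto simp: flat_def\<close>)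
  then show ?thesis using less by (simp add: flat_def)
next
  case equal
  have "((\<lambda>h. (flat k (0 + h) - flat k 0) / h) \<longlongrightarrow> 0) (at 0)"
  proof (rule Lim_transform_eventually[OF flat_tendsto_0[of "Suc k"]])
    show "\<forall>\<^sub>F h in at 0. flat (Suc k) h = (flat k (0 + h) - flat k 0) / h"
      by (auto simp: flat_def eventually_at_filter field_simps)
  qed
  then show ?thesis using equal by (simp add: DERIV_def flat_def)
next
  case greater
  have "((\<lambda>s. (1 / s) ^ k * exp (- 1 / s)) has_real_derivative
      (1 / s) ^ (k + 2) * exp (- 1 / s) - k * ((1 / s) ^ (k + 1) * exp (- 1 / s))) (at s)"
    using greater
    by (auto intro!: derivative_eq_intros simp: field_simps power2_eq_square)
       (cases k; simp add: field_simps)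
  then have "(flat k has_real_derivative
      (1 / s) ^ (k + 2) * exp (- 1 / s) - k * ((1 / s) ^ (k + 1) * exp (- 1 / s))) (at s)"
    by (rule has_field_derivative_transform_within_open[where S = "{0<..}"]) (use greater in \<open>auto simp: flat_def\<close>)
  then show ?thesis using greater by (simp add: flat_def)
qed

lemma smooth_flat:
  assumes q: "smooth q"
  shows "smooth (\<lambda>x. flat m (q x))"
proof -
  have D: "((\<lambda>x. flat m (q x)) has_derivative
      (\<lambda>h. (flat (m + 2) (q x) + (- real m) * flat (m + 1) (q x)) * frechet_derivative q (at x) h)) (at x)" for m x
    using smooth_differentiable[OF q, of x]  has_derivative_compose[OF _ flat_has_derivative[unfolded has_field_derivative_def]]
    by (fastforce simp: frechet_derivative_works)
  have "Ck k (\<lambda>x. flat m (q x))" for k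
  proof (induction k arbitrary: m)
    case 0
    have "continuous_on UNIV (\<lambda>x. flat m (q x))"
      using D by (meson continuous_at_imp_continuous_on has_derivative_continuous)
    then show ?case by simp
  next
    case (Suc k)
    show ?case
      unfolding Ck.simps
    proof (intro conjI allI ballI)
      show "(\<lambda>x. flat m (q x)) differentiable at x" for x
        using D by (auto simp: differentiable_def)
    next
      fix i :: 'a assume "i \<in> Basis"
      with smooth_frechet[OF q] have "Ck k (\<lambda>x. frechet_derivative q (at x) i)" by (simp add: smooth_def)
      then show "Ck k (\<lambda>x. frechet_derivative (\<lambda>x. flat m (q x)) (at x) i)"
        unfolding frechet_derivative_at[OF D, symmetric]
        by (intro Ck_mult Ck_add Suc.IH Ck_const)
    qed
  qed
  then show ?thesis by (simp add: smooth_def)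
qed

text \<open>For \<open>m\<close> tending to infinity the exponent \<open>- 1 / ((m + 1) * q j x)\<close> tends to zero wherever \<open>q j x\<close> is positive,
so the bumps converge boundedly to the indicator of the set on which all \<open>q j\<close> are positive.
Polynomial \<open>q\<close> give compactly supported bumps, trigonometric \<open>q\<close> give periodic ones.\<close>

definition bump :: "('a \<Rightarrow> 'a \<Rightarrow> real) \<Rightarrow> nat \<Rightarrow> 'a::euclidean_space \<Rightarrow> real" where
  "bump q m x = (\<Prod>j\<in>Basis. flat 0 (real (Suc m) * q j x))"

lemma smooth_bump: "(\<And>j. j \<in> Basis \<Longrightarrow> smooth (q j)) \<Longrightarrow> smooth (bump q m)"
  unfolding bump_def[abs_def] by (intro smooth_prod smooth_flat smooth_mult smooth_const) auto

lemma bump_bounds: "0 \<le> bump q m x" "bump q m x \<le> 1"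
proof -
  show "0 \<le> bump q m x" unfolding bump_def by (intro prod_nonneg) (auto simp: flat_def)
  show "bump q m x \<le> 1" unfolding bump_def by (intro prod_le_1) (auto simp: flat_def)
qed

lemma bump_eq_0_iff: "bump q m x = 0 \<longleftrightarrow> (\<exists>j\<in>Basis. q j x \<le> 0)"
  by (auto simp: bump_def flat_def zero_less_mult_iff not_less add_nonneg_pos)

lemma bump_tendsto: "(\<lambda>m. bump q m x) \<longlonglongrightarrow> (if \<forall>j\<in>Basis. 0 < q j x then 1 else 0)"
proof (cases "\<forall>j\<in>Basis. 0 < q j x")
  case True
  have "(\<lambda>m. flat 0 (real (Suc m) * q j x)) \<longlonglongrightarrow> 1" if "j \<in> Basis" for j
  proof -
    have p: "q j x > 0" using True that by auto
    have "(\<lambda>m. exp (- (1 / q j x) * inverse (real (Suc m)))) \<longlonglongrightarrow> exp (- (1 / q j x) * 0)"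
      by (intro tendsto_intros LIMSEQ_inverse_real_of_nat)
    moreover have "exp (- (1 / q j x) * inverse (real (Suc m))) = flat 0 (real (Suc m) * q j x)" for m
      using p by (simp add: flat_def zero_less_mult_iff add_nonneg_pos divide_inverse)
    ultimately show ?thesis by simp
  qed
  then have "(\<lambda>m. bump q m x) \<longlonglongrightarrow> (\<Prod>j\<in>(Basis::'a set). 1)"
    unfolding bump_def by (intro tendsto_prod) auto
  then show ?thesis using True by simp
next
  case False
  then have "bump q m x = 0" for m using bump_eq_0_iff[of q m x] by (auto simp: not_less)
  then show ?thesis using False by auto
qed

section \<open>The fundamental lemma of the calculus of variations\<close>

text \<open>Boxes form an intersection-stable generator of the Borel sets, so Dynkin's argument extends the vanishing of
the integral from boxes to all Borel subsets of a box with closure in \<open>\<Omega>\<close>, and countably many such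
closed boxes exhaust \<open>\<Omega>\<close>. A Lebesgue measurable function is first replaced by a Borel representative.\<close>

lemma AE_zero_of_box_integrals:
  fixes f :: "'a::euclidean_space \<Rightarrow> real"
  assumes \<Omega>: "open \<Omega>" and f: "integrable (lebesgue_on \<Omega>) f"
    and boxes: "\<And>c d. box c d \<noteq> {} \<Longrightarrow> cbox c d \<subseteq> \<Omega> \<Longrightarrow> (LINT x|lebesgue_on \<Omega>. indicator (box c d) x * f x) = 0"
  shows "AE x in lebesgue_on \<Omega>. f x = 0"
proof -
  define f1 where "f1 x = indicator \<Omega> x * f x" for x
  have \<Omega>_sets: "\<Omega> \<in> sets lebesgue" using \<Omega> by auto
  have f1_int: "integrable lebesgue f1"
    using f \<Omega>_sets by (simp add: f1_def[abs_def] integrable_restrict_space)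
  obtain f0 where f0[measurable]: "f0 \<in> borel_measurable lborel" and f01: "AE x in lborel. f1 x = f0 x"
    using completion_ex_borel_measurable_real[of f1 lborel] f1_int by auto
  have f01': "AE x in lebesgue. f1 x = f0 x" using f01 by (rule AE_completion)
  have f0_int: "integrable lborel f0"
  proof -
    have "integrable lebesgue f0"
      using f1_int f01' by (subst integrable_cong_AE[of _ _ f1]) (auto simp: measurable_completion)
    then show ?thesis by (simp add: integrable_completion)
  qed
  have to_lebesgue: "(LINT x|lebesgue_on \<Omega>. indicator A x * f x) = (LINT x|lborel. indicator A x * f0 x)"
    if A[measurable]: "A \<in> sets borel" for A
  proof -
    have "(LINT x|lebesgue_on \<Omega>. indicator A x * f x) = (LINT x|lebesgue. indicator A x * f1 x)"
      using \<Omega>_sets by (simp add: integral_restrict_space f1_def mult_ac)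
    also have "\<dots> = (LINT x|lebesgue. indicator A x * f0 x)"
      using f01' borel_measurable_integrable[OF f1_int] by (intro integral_cong_AE) (auto intro!: borel_measurable_times borel_measurable_indicator simp: measurable_completion)
    also have "\<dots> = (LINT x|lborel. indicator A x * f0 x)"
      by (rule integral_completion) auto
    finally show ?thesis .
  qed
  have B: "AE x in lborel. x \<in> cbox c d \<longrightarrow> f0 x = 0" if cd: "cbox c d \<subseteq> \<Omega>" for c d :: 'a
  proof -
    have zero: "(LINT x|lborel. indicator (A \<inter> box c d) x * f0 x) = 0" if "A \<in> sets borel" for A
    proof -
      have int: "integrable lborel (\<lambda>x. indicator (A \<inter> box c d) x * f0 x)" if "A \<in> sets borel" for A
        using integrable_real_mult_indicator[OF _ f0_int, of "A \<inter> box c d"] that by (simp add: mult.commute)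
      have "Int_stable (range (\<lambda>(a, b). box a b::'a set))"
        by (auto simp: Int_stable_def box_Int_box)
      moreover have "range (\<lambda>(a, b). box a b::'a set) \<subseteq> Pow UNIV" by simp
      moreover have "A \<in> sigma_sets UNIV (range (\<lambda>(a, b). box a b::'a set))"
        using that by (simp add: borel_eq_box)
      ultimately show ?thesis
      proof (induction rule: sigma_sets_induct_disjoint)
        case (basic A)
        then obtain a b where "A = box a b" by auto
        then obtain a' b' where box: "A \<inter> box c d = box a' b'" by (auto simp: box_Int_box)
        show ?case
        proof (cases "box a' b' = {}")
          case False
          then have "cbox a' b' \<subseteq> cbox c d" using box
            by (metis Int_lower2 closure_box closure_mono empty_subsetI inf.absorb_iff2 inf_bot_right)
          then show ?thesis using boxes[OF False] to_lebesgue[of "box a' b'"] cd box by auto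
        qed (simp add: box)
      next
        case empty
        then show ?case by simp
      next
        case (compl A)
        then have A: "A \<in> sets borel" by (simp add: borel_eq_box)
        have UN: "(LINT x|lborel. indicator (box c d) x * f0 x) = 0"
          using boxes[of c d] cd to_lebesgue[of "box c d"] by (cases "box c d = {}") auto
        have "(LINT x|lborel. indicator ((UNIV - A) \<inter> box c d) x * f0 x)
            = (LINT x|lborel. indicator (box c d) x * f0 x - indicator (A \<inter> box c d) x * f0 x)"
          by (rule Bochner_Integration.integral_cong) (auto split: split_indicator)
        also have "\<dots> = 0"
          using compl UN int[OF A] int[of UNIV] by (subst Bochner_Integration.integral_diff) auto
        finally show ?case .
      next
        case (union A)
        from union(2) have A: "A i \<in> sets borel" for i by (auto simp: borel_eq_box)
        have "(LINT x:(\<Union>i. A i) \<inter> box c d|lborel. f0 x) = (\<Sum>i. LINT x:(A i \<inter> box c d)|lborel. f0 x)"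
        proof (subst UN_simps(4)[symmetric], rule lebesgue_integral_countable_add)
          show "A i \<inter> box c d \<inter> (A j \<inter> box c d) = {}" if "i \<noteq> j" for i j
            using union(1) that by (auto simp: disjoint_family_on_def)
          show "set_integrable lborel (\<Union>i. A i \<inter> box c d) f0"
            using f0_int A unfolding set_integrable_def by (intro integrable_mult_indicator) auto
        qed (use A in auto)
        also have "\<dots> = 0" using union(3) by (simp add: set_lebesgue_integral_def)
        finally show ?case
          by (simp add: set_lebesgue_integral_def)
      qed
    qed
    have "AE x in lborel. indicator (box c d) x * f0 x = 0"
    proof (rule density_unique_real)
      show "integrable lborel (\<lambda>x. indicator (box c d) x * f0 x)"
        using integrable_real_mult_indicator[OF _ f0_int, of "box c d"] by (simp add: mult.commute)
    next
      fix A :: "'a set" assume "A \<in> sets lborel"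
      then show "(\<integral>x \<in> A. indicator (box c d) x * f0 x \<partial>lborel) = (\<integral>x \<in> A. 0 \<partial>lborel)"
        using zero[of A] by (simp add: set_lebesgue_integral_def indicator_inter_arith mult.assoc)
    qed auto
    moreover have "AE x in lborel. x \<notin> cbox c d - box c d"
      using negligible_frontier_interval[of c d]
      by (intro AE_not_in) (simp add: negligible_iff_null_sets null_sets_completion_iff)
    ultimately show ?thesis by eventually_elim (auto split: split_indicator_asm)
  qed
  obtain \<D> where \<D>: "countable \<D>" "\<D> \<subseteq> Pow \<Omega>" "\<And>X. X \<in> \<D> \<Longrightarrow> \<exists>a b. X = cbox a b" "\<Union>\<D> = \<Omega>"
    using open_countable_Union_open_cbox[OF \<Omega>] by metis
  have "AE x in lborel. \<forall>X\<in>\<D>. x \<in> X \<longrightarrow> f0 x = 0"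
  proof (subst AE_ball_countable[OF \<D>(1)], rule ballI)
    fix X assume "X \<in> \<D>"
    then obtain c d where "X = cbox c d" "cbox c d \<subseteq> \<Omega>" using \<D>(2,3) by blast
    then show "AE x in lborel. x \<in> X \<longrightarrow> f0 x = 0" using B by blast
  qed
  then have "AE x in lborel. x \<in> \<Omega> \<longrightarrow> f0 x = 0"
    by eventually_elim (use \<D>(4) in blast)
  then have "AE x in lebesgue. x \<in> \<Omega> \<longrightarrow> f0 x = 0" by (rule AE_completion)
  with f01' have "AE x in lebesgue. x \<in> \<Omega> \<longrightarrow> f x = 0"
    by eventually_elim (auto simp: f1_def)
  then show ?thesis using \<Omega>_sets by (simp add: AE_restrict_space_iff)
qed

text \<open>The fundamental lemma of the calculus of variations, in a form that serves both compactly supported and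
periodic test functions: by dominated convergence, vanishing integrals against bumps give vanishing integrals
over boxes.\<close>

lemma AE_zero_of_bump_integrals:
  fixes f :: "'a::euclidean_space \<Rightarrow> real"
  assumes \<Omega>: "open \<Omega>" and f: "integrable (lebesgue_on \<Omega>) f"
    and bumps: "\<And>c d. box c d \<noteq> {} \<Longrightarrow> cbox c d \<subseteq> \<Omega> \<Longrightarrow>
      \<exists>q. (\<forall>j\<in>Basis. smooth (q j)) \<and> (\<forall>x\<in>\<Omega>. x \<in> box c d \<longleftrightarrow> (\<forall>j\<in>Basis. 0 < q j x)) \<and>
          (\<forall>m. (LINT x|lebesgue_on \<Omega>. f x * bump q m x) = 0)"
  shows "AE x in lebesgue_on \<Omega>. f x = 0"
proof (rule AE_zero_of_box_integrals[OF \<Omega> f])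
  fix c d :: 'a assume "box c d \<noteq> {}" "cbox c d \<subseteq> \<Omega>"
  from bumps[OF this] obtain q where "\<forall>j\<in>Basis. smooth (q j)"
    "\<forall>x\<in>\<Omega>. x \<in> box c d \<longleftrightarrow> (\<forall>j\<in>Basis. 0 < q j x)"
    and q3: "\<forall>m. (LINT x|lebesgue_on \<Omega>. f x * bump q m x) = 0" by blast
  then have q: "\<And>j. j \<in> Basis \<Longrightarrow> smooth (q j)"
    "\<And>x. x \<in> \<Omega> \<Longrightarrow> x \<in> box c d \<longleftrightarrow> (\<forall>j\<in>Basis. 0 < q j x)" by blast+
  have [measurable]: "bump q m \<in> borel_measurable (lebesgue_on \<Omega>)" for m
    using smooth_continuous_on[where S = \<Omega>, OF smooth_bump[OF q(1)]] \<Omega>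
    by (simp add: continuous_imp_measurable_on_sets_lebesgue)
  have "(\<lambda>m. LINT x|lebesgue_on \<Omega>. f x * bump q m x) \<longlonglongrightarrow> (LINT x|lebesgue_on \<Omega>. indicator (box c d) x * f x)"
  proof (rule integral_dominated_convergence[where w = "\<lambda>x. norm (f x)"])
    show "AE x in lebesgue_on \<Omega>. (\<lambda>m. f x * bump q m x) \<longlonglongrightarrow> indicator (box c d) x * f x"
    proof (rule AE_I2)
      fix x assume "x \<in> space (lebesgue_on \<Omega>)"
      then have "(if \<forall>j\<in>Basis. 0 < q j x then 1 else 0) = (indicator (box c d) x :: real)"
        using q(2)[of x] by (auto simp: indicator_def)
      with tendsto_mult[OF tendsto_const[of "f x"] bump_tendsto[of q x]]
      show "(\<lambda>m. f x * bump q m x) \<longlonglongrightarrow> indicator (box c d) x * f x"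
        by (simp add: mult.commute)
    qed
    show "AE x in lebesgue_on \<Omega>. norm (f x * bump q m x) \<le> norm (f x)" for m
      using bump_bounds[of q m] by (auto simp: abs_mult mult_left_le)
    show "(\<lambda>x. indicator (box c d) x * f x) \<in> borel_measurable (lebesgue_on \<Omega>)"
    proof (intro borel_measurable_times borel_measurable_integrable[OF f])
      show "(indicator (box c d) :: 'a \<Rightarrow> real) \<in> borel_measurable (lebesgue_on \<Omega>)"
        by (intro measurable_restrict_space1 borel_measurable_indicator) auto
    qed
  qed (use f in auto)
  then show "(LINT x|lebesgue_on \<Omega>. indicator (box c d) x * f x) = 0"
    using LIMSEQ_unique[OF _ tendsto_const] q3 by simp
qed

section \<open>Weak derivatives\<close>

lemma integrable_mult_of_squares:
  fixes u v :: "'b \<Rightarrow> real"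
  assumes "u \<in> borel_measurable M" "v \<in> borel_measurable M"
    and "integrable M (\<lambda>x. (u x)\<^sup>2)" "integrable M (\<lambda>x. (v x)\<^sup>2)"
  shows "integrable M (\<lambda>x. u x * v x)"
proof (rule Bochner_Integration.integrable_bound[where f = "\<lambda>x. (u x)\<^sup>2 + (v x)\<^sup>2"])
  show "AE x in M. norm (u x * v x) \<le> norm ((u x)\<^sup>2 + (v x)\<^sup>2)"
  proof (rule AE_I2)
    fix x
    have "2 * \<bar>u x * v x\<bar> \<le> (u x)\<^sup>2 + (v x)\<^sup>2"
      using sum_squares_bound[of "\<bar>u x\<bar>" "\<bar>v x\<bar>"] by (simp add: abs_mult)
    moreover have "0 \<le> \<bar>u x * v x\<bar>" by simp
    ultimately show "norm (u x * v x) \<le> norm ((u x)\<^sup>2 + (v x)\<^sup>2)"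
      unfolding real_norm_def by linarith
  qed
qed (use assms in auto)

lemma L2_mult_integrable:
  "u \<in> L2 \<Omega> \<Longrightarrow> v \<in> L2 \<Omega> \<Longrightarrow> integrable (lebesgue_on \<Omega>) (\<lambda>x. u x * v x)"
  unfolding L2_def by (auto intro: integrable_mult_of_squares)

lemma L2_linear:
  assumes "u \<in> L2 \<Omega>" "v \<in> L2 \<Omega>"
  shows "(\<lambda>x. c * u x + d * v x) \<in> L2 \<Omega>"
proof -
  have "integrable (lebesgue_on \<Omega>) (\<lambda>x. c\<^sup>2 * (u x)\<^sup>2 + 2 * c * d * (u x * v x) + d\<^sup>2 * (v x)\<^sup>2)"
    using assms L2_mult_integrable[OF assms] by (auto simp: L2_def)
  then show ?thesis
    using assms
    by (auto simp: L2_def power2_sum power_mult_distrib algebra_simps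
        intro!: borel_measurable_add borel_measurable_times)
qed

lemma L2_sum:
  assumes "\<And>k. k \<in> K \<Longrightarrow> f k \<in> L2 \<Omega>"
  shows "(\<lambda>x. \<Sum>k\<in>K. f k x) \<in> L2 \<Omega>"
  using assms
proof (induction K rule: infinite_finite_induct)
  case (insert k K)
  then show ?case using L2_linear[of "f k" \<Omega> "\<lambda>x. \<Sum>k\<in>K. f k x" 1 1] by simp
qed (auto simp: L2_def)

text \<open>Boundedness of the domain makes every smooth function, with or without compact support, square integrable: it
is bounded on the compact closure.\<close>

lemma smooth_in_L2:
  fixes \<psi> :: "'a::euclidean_space \<Rightarrow> real"
  assumes \<Omega>: "open \<Omega>" "bounded \<Omega>" and \<psi>: "smooth \<psi>"
  shows "\<psi> \<in> L2 \<Omega>"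
proof -
  have fin: "finite_measure (lebesgue_on \<Omega>)"
    using \<Omega> by (intro finite_measure_lebesgue_on) (simp add: lmeasurable_open)
  have "compact (\<psi> ` closure \<Omega>)"
    using \<Omega> by (intro compact_continuous_image smooth_continuous_on[OF \<psi>]) (simp add: compact_closure)
  then obtain B where B: "\<And>x. x \<in> \<Omega> \<Longrightarrow> \<bar>\<psi> x\<bar> \<le> B"
    by (force dest: compact_imp_bounded simp: bounded_iff closure_subset[THEN subsetD])
  have m: "\<psi> \<in> borel_measurable (lebesgue_on \<Omega>)"
    using smooth_continuous_on[OF \<psi>] \<Omega> by (simp add: continuous_imp_measurable_on_sets_lebesgue)
  have "integrable (lebesgue_on \<Omega>) (\<lambda>x. (\<psi> x)\<^sup>2)"
  proof (rule finite_measure.integrable_const_bound[OF fin, where B = "B\<^sup>2"])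
    show "AE x in lebesgue_on \<Omega>. norm ((\<psi> x)\<^sup>2) \<le> B\<^sup>2"
      using B by (intro AE_I2) (metis abs_le_square_iff abs_of_nonneg abs_ge_zero order_trans norm_power real_norm_def power_mono Int_iff space_lebesgue_on)
  qed (use m in auto)
  with m show ?thesis by (simp add: L2_def)
qed

text \<open>The \<open>j\<close>-th factor of the bump comes from the parabola that is positive exactly between the two faces of the
box orthogonal to \<open>j\<close>.\<close>

lemma has_weak_partial_unique:
  fixes u :: "'a::euclidean_space \<Rightarrow> real"
  assumes \<Omega>: "open \<Omega>" "bounded \<Omega>"
    and g: "has_weak_partial \<Omega> i u g" and h: "has_weak_partial \<Omega> i u h"
  shows "AE x in lebesgue_on \<Omega>. g x = h x"
proof -
  have L2: "g \<in> L2 \<Omega>" "h \<in> L2 \<Omega>" using g h by (auto simp: has_weak_partial_def)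
  have int: "integrable (lebesgue_on \<Omega>) (\<lambda>x. g x - h x)"
    using L2_mult_integrable[OF _ smooth_in_L2[OF \<Omega> smooth_const[of 1]]] L2 by force
  have "AE x in lebesgue_on \<Omega>. g x - h x = 0"
  proof (rule AE_zero_of_bump_integrals[OF \<Omega>(1) int])
    fix c d :: 'a assume cd: "box c d \<noteq> {}" "cbox c d \<subseteq> \<Omega>"
    define q where "q j x = (j \<bullet> x + - (c \<bullet> j)) * ((- j) \<bullet> x + d \<bullet> j)" for j x :: 'a
    have q: "smooth (q j)" for j
      unfolding q_def by (intro smooth_mult smooth_affine)
    have box: "x \<in> box c d \<longleftrightarrow> (\<forall>j\<in>Basis. 0 < q j x)" for x
    proof -
      have "0 < q j x \<longleftrightarrow> c \<bullet> j < x \<bullet> j \<and> x \<bullet> j < d \<bullet> j" if "j \<in> Basis" for j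
      proof -
        have "c \<bullet> j < d \<bullet> j" using cd(1) that by (simp add: box_ne_empty)
        then show ?thesis by (auto simp: q_def zero_less_mult_iff inner_commute)
      qed
      then show ?thesis by (simp add: mem_box)
    qed
    have zero: "(LINT x|lebesgue_on \<Omega>. (g x - h x) * bump q m x) = 0" for m
    proof -
      have sm: "smooth (bump q m)" by (rule smooth_bump[OF q])
      have "{x. bump q m x \<noteq> 0} = box c d"
        using box by (auto simp: bump_eq_0_iff not_le)
      then have "compactly_supported_in \<Omega> (bump q m)"
        using cd by (simp add: compactly_supported_in_def closure_box)
      then have "l2_inner \<Omega> g (bump q m) = l2_inner \<Omega> h (bump q m)"
        using g h sm unfolding has_weak_partial_def by force
      then show ?thesis
        using L2_mult_integrable[OF L2(1) smooth_in_L2[OF \<Omega> sm]] L2_mult_integrable[OF L2(2) smooth_in_L2[OF \<Omega> sm]]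
        by (simp add: l2_inner_def algebra_simps)
    qed
    show "\<exists>q. (\<forall>j\<in>Basis. smooth (q j)) \<and> (\<forall>x\<in>\<Omega>. (x \<in> box c d) = (\<forall>j\<in>Basis. 0 < q j x)) \<and>
          (\<forall>m. (LINT x|lebesgue_on \<Omega>. (g x - h x) * bump q m x) = 0)"
      using q box zero by (intro exI[of _ q]) auto
  qed
  then show ?thesis by simp
qed

lemma l2_inner_linear_left:
  fixes u v w :: "'a::euclidean_space \<Rightarrow> real"
  assumes "u \<in> L2 \<Omega>" "v \<in> L2 \<Omega>" "w \<in> L2 \<Omega>"
  shows "l2_inner \<Omega> (\<lambda>x. c * u x + d * v x) w = c * l2_inner \<Omega> u w + d * l2_inner \<Omega> v w"
proof -
  have "l2_inner \<Omega> (\<lambda>x. c * u x + d * v x) w = (LINT x|lebesgue_on \<Omega>. c * (u x * w x) + d * (v x * w x))"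
    by (simp add: l2_inner_def algebra_simps)
  also have "\<dots> = c * l2_inner \<Omega> u w + d * l2_inner \<Omega> v w"
    using L2_mult_integrable[OF assms(1,3)] L2_mult_integrable[OF assms(2,3)] by (simp add: l2_inner_def)
  finally show ?thesis .
qed

lemma has_weak_partial_linear:
  fixes u v :: "'a::euclidean_space \<Rightarrow> real"
  assumes \<Omega>: "open \<Omega>" "bounded \<Omega>" and i: "i \<in> Basis"
    and "has_weak_partial \<Omega> i u g" "has_weak_partial \<Omega> i v h"
  shows "has_weak_partial \<Omega> i (\<lambda>x. c * u x + d * v x) (\<lambda>x. c * g x + d * h x)"
  using assms smooth_in_L2[OF \<Omega>] smooth_in_L2[OF \<Omega> smooth_frechet[OF _ i]]
  by (auto simp: has_weak_partial_def l2_inner_linear_left L2_linear algebra_simps)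

lemma l2_inner_cong_AE:
  fixes u :: "'a::euclidean_space \<Rightarrow> real"
  assumes "u \<in> L2 \<Omega>" "u' \<in> L2 \<Omega>" "v \<in> L2 \<Omega>" "AE x in lebesgue_on \<Omega>. u x = u' x"
  shows "l2_inner \<Omega> u v = l2_inner \<Omega> u' v"
  unfolding l2_inner_def
proof (rule integral_cong_AE)
  show "AE x in lebesgue_on \<Omega>. u x \<bullet> v x = u' x \<bullet> v x"
    using assms(4) by eventually_elim simp
qed (use assms in \<open>auto simp: L2_def\<close>)

lemma has_weak_partial_cong_AE:
  fixes u :: "'a::euclidean_space \<Rightarrow> real"
  assumes \<Omega>: "open \<Omega>" "bounded \<Omega>" and i: "i \<in> Basis"
    and g: "has_weak_partial \<Omega> i u g" and u': "u' \<in> L2 \<Omega>" "AE x in lebesgue_on \<Omega>. u x = u' x"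
  shows "has_weak_partial \<Omega> i u' g"
  using assms l2_inner_cong_AE[OF _ u'(1) smooth_in_L2[OF \<Omega> smooth_frechet[OF _ i]] u'(2)]
  by (auto simp: has_weak_partial_def)

lemma weak_partial_works:
  assumes "u \<in> H1 \<Omega>" "i \<in> Basis"
  shows "has_weak_partial \<Omega> i u (weak_partial \<Omega> i u)"
  using assms someI_ex[of "has_weak_partial \<Omega> i u"] by (simp add: weak_partial_def H1_def)

lemma weak_partial_L2:
  assumes "u \<in> H1 \<Omega>" "i \<in> Basis" shows "weak_partial \<Omega> i u \<in> L2 \<Omega>"
  using weak_partial_works[OF assms] by (simp add: has_weak_partial_def)

text \<open>The arbitrarily chosen representative agrees almost everywhere with any weak derivative one can exhibit. This
is what makes the chosen gradients and Laplacians linear up to null sets.\<close>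

lemma weak_partial_AE:
  fixes u :: "'a::euclidean_space \<Rightarrow> real"
  assumes \<Omega>: "open \<Omega>" "bounded \<Omega>" and g: "has_weak_partial \<Omega> i u g"
  shows "AE x in lebesgue_on \<Omega>. weak_partial \<Omega> i u x = g x"
  using has_weak_partial_unique[OF \<Omega> _ g] someI[of "has_weak_partial \<Omega> i u", OF g]
  by (simp add: weak_partial_def)

context
  fixes \<Omega> :: "'a::euclidean_space set" and u v :: "'a \<Rightarrow> real" and c d :: real
  assumes \<Omega>: "open \<Omega>" "bounded \<Omega>"
begin

lemma H1_linear:
  assumes "u \<in> H1 \<Omega>" "v \<in> H1 \<Omega>"
  shows "(\<lambda>x. c * u x + d * v x) \<in> H1 \<Omega>"
  using assms has_weak_partial_linear[OF \<Omega>] by (auto simp: H1_def L2_linear) blast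

lemma weak_partial_linear:
  assumes "u \<in> H1 \<Omega>" "v \<in> H1 \<Omega>" "i \<in> Basis"
  shows "AE x in lebesgue_on \<Omega>. weak_partial \<Omega> i (\<lambda>x. c * u x + d * v x) x
           = c * weak_partial \<Omega> i u x + d * weak_partial \<Omega> i v x"
  using assms by (intro weak_partial_AE \<Omega> has_weak_partial_linear weak_partial_works)

lemma has_weak_second_partial_linear:
  assumes uv: "u \<in> H2 \<Omega>" "v \<in> H2 \<Omega>" and i: "i \<in> Basis" and j: "j \<in> Basis"
  shows "has_weak_partial \<Omega> j (weak_partial \<Omega> i (\<lambda>x. c * u x + d * v x))
     (\<lambda>x. c * weak_partial \<Omega> j (weak_partial \<Omega> i u) x + d * weak_partial \<Omega> j (weak_partial \<Omega> i v) x)"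
proof (rule has_weak_partial_cong_AE[OF \<Omega> j])
  have H1: "u \<in> H1 \<Omega>" "v \<in> H1 \<Omega>" using uv by (auto simp: H2_def)
  show "has_weak_partial \<Omega> j (\<lambda>x. c * weak_partial \<Omega> i u x + d * weak_partial \<Omega> i v x)
     (\<lambda>x. c * weak_partial \<Omega> j (weak_partial \<Omega> i u) x + d * weak_partial \<Omega> j (weak_partial \<Omega> i v) x)"
    using uv i j by (intro \<Omega> has_weak_partial_linear weak_partial_works) (auto simp: H2_def)
  show "AE x in lebesgue_on \<Omega>. c * weak_partial \<Omega> i u x + d * weak_partial \<Omega> i v x
      = weak_partial \<Omega> i (\<lambda>x. c * u x + d * v x) x"
    using weak_partial_linear[OF H1 i] by eventually_elim simp
  show "weak_partial \<Omega> i (\<lambda>x. c * u x + d * v x) \<in> L2 \<Omega>"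
    by (rule weak_partial_L2[OF H1_linear[OF H1] i])
qed

lemma H2_linear:
  assumes "u \<in> H2 \<Omega>" "v \<in> H2 \<Omega>"
  shows "(\<lambda>x. c * u x + d * v x) \<in> H2 \<Omega>"
proof -
  have H1: "u \<in> H1 \<Omega>" "v \<in> H1 \<Omega>" using assms by (auto simp: H2_def)
  have "weak_partial \<Omega> i (\<lambda>x. c * u x + d * v x) \<in> H1 \<Omega>" if "i \<in> Basis" for i
    using weak_partial_L2[OF H1_linear[OF H1] that] has_weak_second_partial_linear[OF assms that]
    unfolding H1_def by blast
  then show ?thesis using H1_linear[OF H1] by (simp add: H2_def)
qed

lemma weak_laplacian_linear:
  assumes uv: "u \<in> H2 \<Omega>" "v \<in> H2 \<Omega>"
  shows "AE x in lebesgue_on \<Omega>. weak_laplacian \<Omega> (\<lambda>x. c * u x + d * v x) x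
           = c * weak_laplacian \<Omega> u x + d * weak_laplacian \<Omega> v x"
proof -
  have "AE x in lebesgue_on \<Omega>. \<forall>i\<in>Basis. weak_partial \<Omega> i (weak_partial \<Omega> i (\<lambda>x. c * u x + d * v x)) x
      = c * weak_partial \<Omega> i (weak_partial \<Omega> i u) x + d * weak_partial \<Omega> i (weak_partial \<Omega> i v) x"
    using has_weak_second_partial_linear[OF uv] weak_partial_AE[OF \<Omega>] by (intro AE_finite_allI) auto
  then show ?thesis
    by eventually_elim (simp add: weak_laplacian_def sum.distrib sum_distrib_left)
qed

lemma weak_grad_linear:
  assumes uv: "u \<in> H1 \<Omega>" "v \<in> H1 \<Omega>"
  shows "AE x in lebesgue_on \<Omega>. weak_grad \<Omega> (\<lambda>x. c * u x + d * v x) x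
           = c *\<^sub>R weak_grad \<Omega> u x + d *\<^sub>R weak_grad \<Omega> v x"
proof -
  have "AE x in lebesgue_on \<Omega>. \<forall>i\<in>Basis. weak_partial \<Omega> i (\<lambda>x. c * u x + d * v x) x
      = c * weak_partial \<Omega> i u x + d * weak_partial \<Omega> i v x"
    using weak_partial_linear[OF uv] by (intro AE_finite_allI) auto
  then show ?thesis
    by eventually_elim (simp add: weak_grad_def sum.distrib scaleR_sum_right scaleR_add_left)
qed

end

lemma weak_laplacian_L2: "u \<in> H2 \<Omega> \<Longrightarrow> weak_laplacian \<Omega> u \<in> L2 \<Omega>"
  unfolding weak_laplacian_def[abs_def] by (intro L2_sum weak_partial_L2) (auto simp: H2_def)

lemma weak_grad_inner:
  "weak_grad \<Omega> u x \<bullet> weak_grad \<Omega> v x = (\<Sum>i\<in>Basis. weak_partial \<Omega> i u x * weak_partial \<Omega> i v x)"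
  unfolding weak_grad_def by (subst euclidean_inner) simp

lemma weak_grad_inner_integrable:
  assumes "u \<in> H1 \<Omega>" "v \<in> H1 \<Omega>"
  shows "integrable (lebesgue_on \<Omega>) (\<lambda>x. weak_grad \<Omega> u x \<bullet> weak_grad \<Omega> v x)"
  unfolding weak_grad_inner using assms
  by (intro Bochner_Integration.integrable_sum L2_mult_integrable weak_partial_L2)

section \<open>Translations of periodic functions\<close>

text \<open>A periodic test function moved along a coordinate direction is again a periodic test function.\<close>

lemma Ck_translate: "Ck k f \<Longrightarrow> Ck k (\<lambda>x. f (x + c))"
proof (induction k arbitrary: f)
  case 0
  then show ?case by (auto intro!: continuous_on_compose2[of UNIV f] continuous_intros)
next
  case (Suc k)
  have D: "((\<lambda>x. f (x + c)) has_derivative frechet_derivative f (at (x + c))) (at x)" for x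
  proof -
    have "(f has_derivative frechet_derivative f (at (x + c))) (at (x + c))"
      using Suc.prems by (simp add: frechet_derivative_works[symmetric])
    then have "((\<lambda>x. f (x + c)) has_derivative (\<lambda>h. frechet_derivative f (at (x + c)) h)) (at x)"
      by (rule has_derivative_compose[rotated]) (auto intro!: derivative_eq_intros)
    then show ?thesis by simp
  qed
  show ?case
    using Suc D by (auto simp: frechet_derivative_at[OF D, symmetric] differentiable_def)
qed

lemma smooth_translate: "smooth f \<Longrightarrow> smooth (\<lambda>x. f (x + c))"
  by (simp add: smooth_def Ck_translate)

lemma frechet_derivative_translate:
  assumes "f differentiable (at (x + c))"
  shows "frechet_derivative (\<lambda>x. f (x + c)) (at x) = frechet_derivative f (at (x + c))"
proof -
  have "(f has_derivative frechet_derivative f (at (x + c))) (at (x + c))"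
    using assms by (simp add: frechet_derivative_works[symmetric])
  then have "((\<lambda>x. f (x + c)) has_derivative (\<lambda>h. frechet_derivative f (at (x + c)) h)) (at x)"
    by (rule has_derivative_compose[rotated]) (auto intro!: derivative_eq_intros)
  then show ?thesis by (simp add: frechet_derivative_at[symmetric])
qed

text \<open>Integration by parts in direction \<open>i\<close> is obtained by moving functions around the cell in direction \<open>i\<close>
only; the other coordinates stay fixed.\<close>

locale periodic_cell =
  fixes a b i :: "'a::euclidean_space"
  assumes i: "i \<in> Basis" and ne: "box a b \<noteq> {}"
begin

definition L :: real where "L = (b - a) \<bullet> i"

text \<open>Half-open, so that wrapping around in direction \<open>i\<close> is a bijection of the cell and no null sets have to be
discarded when functions are translated.\<close>

definition cell :: "'a set" where "cell = {x. \<forall>j\<in>Basis. a \<bullet> j \<le> x \<bullet> j \<and> x \<bullet> j < b \<bullet> j}"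

abbreviation M :: "'a measure" where "M \<equiv> restrict_space lborel cell"

abbreviation N :: "real \<Rightarrow> real measure" where "N s \<equiv> restrict_space lborel {0..s}"

definition ip :: "('a \<Rightarrow> real) \<Rightarrow> ('a \<Rightarrow> real) \<Rightarrow> real" where
  "ip P Q = (LINT x|M. P x * Q x)"

definition shift :: "real \<Rightarrow> ('a \<Rightarrow> real) \<Rightarrow> 'a \<Rightarrow> real" where
  "shift s P x = P (x + s *\<^sub>R i)"

definition periodic :: "('a \<Rightarrow> real) \<Rightarrow> bool" where "periodic P \<longleftrightarrow> shift L P = P"

text \<open>Periodic Borel functions defined on the whole space, instead of functions on the cell, can be translated
without leaving the domain, and compositions with translations stay measurable.\<close>

definition sq :: "('a \<Rightarrow> real) \<Rightarrow> bool" where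
  "sq P \<longleftrightarrow> P \<in> borel_measurable borel \<and> periodic P \<and> integrable M (\<lambda>x. (P x)\<^sup>2)"

lemma L_pos: "0 < L"
  using ne i by (simp add: L_def box_ne_empty inner_diff_left)

lemma cell_sets[measurable]: "cell \<in> sets borel"
  unfolding cell_def by measurable

lemma cell_finite: "emeasure lborel cell < \<infinity>"
proof -
  have "cell \<subseteq> cbox a b" by (auto simp: cell_def mem_box less_imp_le)
  then have "emeasure lborel cell \<le> emeasure lborel (cbox a b)" by (intro emeasure_mono) auto
  then show ?thesis using emeasure_lborel_cbox_finite le_less_trans by blast
qed

sublocale M: finite_measure M
  using cell_finite by (intro finite_measureI) (simp add: emeasure_restrict_space space_restrict_space)

lemma N_finite: "finite_measure (N s)"
  by (intro finite_measureI)
     (use emeasure_lborel_cbox_finite[of 0 s] in \<open>simp add: emeasure_restrict_space space_restrict_space\<close>)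

lemma measurable_M: "f \<in> borel_measurable borel \<Longrightarrow> f \<in> borel_measurable M"
  by (simp add: measurable_restrict_space1)

definition wrap :: "'a \<Rightarrow> 'a" where
  "wrap x = x - (of_int \<lfloor>(x \<bullet> i - a \<bullet> i) / L\<rfloor> * L) *\<^sub>R i"

lemma wrap_measurable[measurable]: "wrap \<in> borel \<rightarrow>\<^sub>M borel"
  unfolding wrap_def[abs_def] by measurable

lemma wrap_periodic: "wrap (x + L *\<^sub>R i) = wrap x"
proof -
  have "((x + L *\<^sub>R i) \<bullet> i - a \<bullet> i) / L = (x \<bullet> i - a \<bullet> i) / L + 1"
    using i L_pos by (simp add: inner_add_left field_simps)
  then have "\<lfloor>((x + L *\<^sub>R i) \<bullet> i - a \<bullet> i) / L\<rfloor> = \<lfloor>(x \<bullet> i - a \<bullet> i) / L\<rfloor> + 1" by simp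
  then show ?thesis by (simp add: wrap_def algebra_simps)
qed

lemma wrap_cell: "x \<in> cell \<Longrightarrow> wrap x = x"
proof -
  assume "x \<in> cell"
  then have "a \<bullet> i \<le> x \<bullet> i" "x \<bullet> i < b \<bullet> i" using i by (auto simp: cell_def)
  then have "0 \<le> (x \<bullet> i - a \<bullet> i) / L" "(x \<bullet> i - a \<bullet> i) / L < 1"
    using L_pos by (auto simp: L_def inner_diff_left)
  then have "\<lfloor>(x \<bullet> i - a \<bullet> i) / L\<rfloor> = 0" by (simp add: floor_eq_iff)
  then show ?thesis by (simp add: wrap_def)
qed

lemma periodic_nat: "periodic P \<Longrightarrow> P (x + (of_nat n * L) *\<^sub>R i) = P x"
proof (induction n)
  case (Suc n)
  then have "P (x + (of_nat n * L) *\<^sub>R i + L *\<^sub>R i) = P (x + (of_nat n * L) *\<^sub>R i)"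
    by (metis periodic_def shift_def)
  with Suc show ?case by (simp add: algebra_simps)
qed simp

lemma periodic_int: "periodic P \<Longrightarrow> P (x + (of_int n * L) *\<^sub>R i) = P x"
proof (cases n rule: int_cases2)
  case (nonpos m)
  assume "periodic P"
  from periodic_nat[OF this, of "x + (of_int n * L) *\<^sub>R i" m] show ?thesis
    using nonpos by (simp add: algebra_simps)
qed (simp add: periodic_nat)

lemma periodic_wrap: "periodic P \<Longrightarrow> P (wrap x) = P x"
  using periodic_int[of P x "- \<lfloor>(x \<bullet> i - a \<bullet> i) / L\<rfloor>"] by (simp add: wrap_def)

lemma emeasure_translate:
  fixes c :: 'a
  assumes [measurable]: "A \<in> sets borel"
  shows "emeasure lborel {x. x + c \<in> A} = emeasure lborel A"
proof -
  have "emeasure lborel A = emeasure (distr lborel borel ((+) c)) A" by (simp add: lborel_distr_plus)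
  also have "\<dots> = emeasure lborel {x. x + c \<in> A}"
    by (subst emeasure_distr) (auto simp: vimage_def add.commute)
  finally show ?thesis by simp
qed

text \<open>Cut the cell where its translate leaves it: the first part is moved by \<open>s\<close>, the second by \<open>s - L\<close>, and the
two images tile the cell again.\<close>

lemma emeasure_cell_shift:
  assumes A[measurable]: "A \<in> sets borel" and per: "\<And>x. x + L *\<^sub>R i \<in> A \<longleftrightarrow> x \<in> A"
    and s: "0 \<le> s" "s \<le> L"
  shows "emeasure lborel {x \<in> cell. x + s *\<^sub>R i \<in> A} = emeasure lborel (cell \<inter> A)"
proof -
  define A1 where "A1 = {x \<in> cell \<inter> A. a \<bullet> i + s \<le> x \<bullet> i}"
  define A2 where "A2 = {x \<in> cell \<inter> A. x \<bullet> i < a \<bullet> i + s}"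
  have [measurable]: "A1 \<in> sets borel" "A2 \<in> sets borel" unfolding A1_def A2_def by measurable
  have comp: "(x + r *\<^sub>R i) \<bullet> j = x \<bullet> j + (if j = i then r else 0)" if "j \<in> Basis" for x r j
    using i that by (auto simp: inner_add_left inner_Basis)
  have memc: "x + r *\<^sub>R i \<in> cell \<longleftrightarrow> (\<forall>j\<in>Basis - {i}. a \<bullet> j \<le> x \<bullet> j \<and> x \<bullet> j < b \<bullet> j)
     \<and> a \<bullet> i \<le> x \<bullet> i + r \<and> x \<bullet> i + r < b \<bullet> i" for x r
    using i by (auto simp: cell_def comp)
  have per': "x + (s - L) *\<^sub>R i \<in> A \<longleftrightarrow> x + s *\<^sub>R i \<in> A" for x
    using per[of "x + (s - L) *\<^sub>R i"] by (simp add: algebra_simps)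
  have bL: "b \<bullet> i = a \<bullet> i + L" by (simp add: L_def inner_diff_left)
  have eq: "{x \<in> cell. x + s *\<^sub>R i \<in> A} = {x. x + s *\<^sub>R i \<in> A1} \<union> {x. x + (s - L) *\<^sub>R i \<in> A2}"
    unfolding A1_def A2_def using memc[of _ 0] s
    by (auto simp: memc per' comp i bL)
  have "emeasure lborel {x \<in> cell. x + s *\<^sub>R i \<in> A}
      = emeasure lborel {x. x + s *\<^sub>R i \<in> A1} + emeasure lborel {x. x + (s - L) *\<^sub>R i \<in> A2}"
    unfolding eq
  proof (rule plus_emeasure[symmetric])
    show "{x. x + s *\<^sub>R i \<in> A1} \<inter> {x. x + (s - L) *\<^sub>R i \<in> A2} = {}"
      unfolding A1_def A2_def using s by (auto simp: memc bL)
  qed measurable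
  also have "\<dots> = emeasure lborel A1 + emeasure lborel A2" by (simp add: emeasure_translate)
  also have "\<dots> = emeasure lborel (A1 \<union> A2)"
    by (rule plus_emeasure) (auto simp: A1_def A2_def)
  also have "A1 \<union> A2 = cell \<inter> A" by (auto simp: A1_def A2_def)
  finally show ?thesis .
qed

lemma distr_shift:
  assumes s: "0 \<le> s" "s \<le> L"
  shows "distr M borel (\<lambda>x. wrap (x + s *\<^sub>R i)) = distr M borel wrap"
proof (rule measure_eqI)
  fix A :: "'a set" assume "A \<in> sets (distr M borel (\<lambda>x. wrap (x + s *\<^sub>R i)))"
  then have A[measurable]: "A \<in> sets borel" by simp
  define B where "B = wrap -` A"
  have [measurable]: "B \<in> sets borel" unfolding B_def using measurable_sets[OF wrap_measurable A] by simp
  have "emeasure (distr M borel (\<lambda>x. wrap (x + s *\<^sub>R i))) A = emeasure lborel {x \<in> cell. x + s *\<^sub>R i \<in> B}"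
    by (subst emeasure_distr)
       (auto simp: B_def vimage_def emeasure_restrict_space space_restrict_space intro!: measurable_restrict_space1 arg_cong[where f = "emeasure lborel"])
  also have "\<dots> = emeasure lborel (cell \<inter> B)"
    using s by (intro emeasure_cell_shift) (simp_all, simp add: B_def wrap_periodic)
  also have "\<dots> = emeasure (distr M borel wrap) A"
    by (subst emeasure_distr)
       (auto simp: B_def vimage_def emeasure_restrict_space space_restrict_space intro!: measurable_restrict_space1 arg_cong[where f = "emeasure lborel"])
  finally show "emeasure (distr M borel (\<lambda>x. wrap (x + s *\<^sub>R i))) A = emeasure (distr M borel wrap) A" .
qed simp

lemma shift_invariant_nonneg:
  assumes P: "P \<in> borel_measurable borel" "periodic P" and s: "0 \<le> s" "s \<le> L"
  shows "integrable M (shift s P) \<longleftrightarrow> integrable M P" "(LINT x|M. shift s P x) = (LINT x|M. P x)"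
proof -
  have m: "(\<lambda>x. wrap (x + s *\<^sub>R i)) \<in> M \<rightarrow>\<^sub>M borel" "wrap \<in> M \<rightarrow>\<^sub>M borel"
    by (auto intro!: measurable_restrict_space1)
  have 1: "P (wrap (x + s *\<^sub>R i)) = shift s P x" "P (wrap x) = P x" for x
    using periodic_wrap[OF P(2)] by (auto simp: shift_def)
  show "integrable M (shift s P) \<longleftrightarrow> integrable M P"
    using integrable_distr_eq[OF m(1) P(1)] integrable_distr_eq[OF m(2) P(1)] distr_shift[OF s] 1
    by (simp add: shift_def[abs_def])
  show "(LINT x|M. shift s P x) = (LINT x|M. P x)"
    using integral_distr[OF m(1) P(1)] integral_distr[OF m(2) P(1)] distr_shift[OF s] 1 by simp
qed

lemma periodicD: "periodic P \<Longrightarrow> P (x + L *\<^sub>R i) = P x"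
  by (metis periodic_def shift_def)

lemma shift_shift: "shift s (shift r P) = shift (s + r) P"
  by (simp add: shift_def fun_eq_iff scaleR_add_left add.assoc)

lemma shift_periodic_eq: "periodic P \<Longrightarrow> shift (s + L) P = shift s P"
  by (metis periodic_def shift_shift)

lemma shift_invariant:
  assumes P: "P \<in> borel_measurable borel" "periodic P" and s: "\<bar>s\<bar> \<le> L"
  shows "integrable M (shift s P) \<longleftrightarrow> integrable M P" "(LINT x|M. shift s P x) = (LINT x|M. P x)"
  using shift_invariant_nonneg[OF P, of s] shift_invariant_nonneg[OF P, of "s + L"] shift_periodic_eq[OF P(2), of s] s
  by (cases "0 \<le> s"; simp)+

lemma periodic_shift: "periodic P \<Longrightarrow> periodic (shift s P)"
  by (metis periodic_def shift_shift add.commute)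

lemma shift_measurable: "P \<in> borel_measurable borel \<Longrightarrow> shift s P \<in> borel_measurable borel"
  unfolding shift_def[abs_def] by (rule measurable_compose[of "\<lambda>x. x + s *\<^sub>R i" _ borel]) measurable

lemma sq_shift:
  assumes "sq P" "\<bar>s\<bar> \<le> L" shows "sq (shift s P)"
proof -
  have "periodic (\<lambda>x. (P x)\<^sup>2)" using assms by (auto simp: sq_def periodic_def shift_def fun_eq_iff)
  then have "integrable M (shift s (\<lambda>x. (P x)\<^sup>2))"
    using assms by (subst shift_invariant) (auto simp: sq_def)
  then show ?thesis
    using assms by (simp add: sq_def periodic_shift shift_measurable) (simp add: shift_def[abs_def])
qed

lemma sq_mult_integrable: "sq P \<Longrightarrow> sq Q \<Longrightarrow> integrable M (\<lambda>x. P x * Q x)"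
  unfolding sq_def by (auto intro: integrable_mult_of_squares measurable_M)

lemma sq_linear:
  assumes "sq P" "sq Q" shows "sq (\<lambda>x. c * P x + d * Q x)"
proof -
  have "integrable M (\<lambda>x. c\<^sup>2 * (P x)\<^sup>2 + 2 * c * d * (P x * Q x) + d\<^sup>2 * (Q x)\<^sup>2)"
    using assms sq_mult_integrable[OF assms] by (auto simp: sq_def)
  then show ?thesis
    using assms
    by (auto simp: sq_def power2_sum power_mult_distrib algebra_simps periodic_def shift_def fun_eq_iff
        intro!: borel_measurable_add borel_measurable_times)
qed

lemma sq_diff: "sq P \<Longrightarrow> sq Q \<Longrightarrow> sq (\<lambda>x. P x - Q x)"
  using sq_linear[of P Q 1 "-1"] by simp

lemma sq_const: "sq (\<lambda>x. c)"
  by (auto simp: sq_def periodic_def shift_def)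

lemma ip_commute: "ip P Q = ip Q P"
  by (simp add: ip_def mult.commute)

lemma ip_linear:
  assumes "sq P" "sq Q" "sq R"
  shows "ip (\<lambda>x. c * P x + d * Q x) R = c * ip P R + d * ip Q R"
  using sq_mult_integrable[OF assms(1,3)] sq_mult_integrable[OF assms(2,3)]
  by (simp add: ip_def distrib_right mult.assoc)

lemma ip_diff:
  assumes "sq P" "sq Q" "sq R"
  shows "ip (\<lambda>x. P x - Q x) R = ip P R - ip Q R"
  using ip_linear[OF assms, of 1 "-1"] by simp

lemma ip_shift:
  assumes "sq P" "sq Q" "\<bar>s\<bar> \<le> L"
  shows "ip (shift s P) (shift s Q) = ip P Q"
proof -
  have "periodic (\<lambda>x. P x * Q x)" using assms by (auto simp: sq_def periodic_def shift_def fun_eq_iff)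
  then have "(LINT x|M. shift s (\<lambda>x. P x * Q x) x) = ip P Q"
    unfolding ip_def using assms by (intro shift_invariant) (auto simp: sq_def)
  then show ?thesis by (simp add: ip_def shift_def)
qed

lemma ip_nonneg: "0 \<le> ip P P"
  unfolding ip_def by (intro Bochner_Integration.integral_nonneg) auto

text \<open>Expand the square of \<open>l * P + Q\<close> and of \<open>l * P - Q\<close>.\<close>

lemma ip_young:
  assumes PQ: "sq P" "sq Q" and l: "0 < l"
  shows "\<bar>ip P Q\<bar> \<le> l / 2 * ip P P + 1 / (2 * l) * ip Q Q"
proof -
  have *: "0 \<le> l\<^sup>2 * ip P P + 2 * l * c * ip P Q + ip Q Q" if c: "c\<^sup>2 = 1" for c
  proof -
    let ?S = "\<lambda>x. l * P x + c * Q x"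
    have S: "sq ?S" by (rule sq_linear[OF PQ])
    have "ip ?S ?S = l * ip P ?S + c * ip Q ?S" by (rule ip_linear[OF PQ S])
    also have "ip P ?S = l * ip P P + c * ip P Q"
      using ip_linear[OF PQ PQ(1), of l c] by (simp add: ip_commute)
    also have "ip Q ?S = l * ip P Q + c * ip Q Q"
      using ip_linear[OF PQ PQ(2), of l c] by (simp add: ip_commute)
    finally have "ip ?S ?S = l\<^sup>2 * ip P P + 2 * l * c * ip P Q + c\<^sup>2 * ip Q Q"
      by (simp add: algebra_simps power2_eq_square)
    then show ?thesis using ip_nonneg[of ?S] c by simp
  qed
  from *[of 1] *[of "-1"] have "2 * l * \<bar>ip P Q\<bar> \<le> l\<^sup>2 * ip P P + ip Q Q"
    by (simp add: abs_if)
  then show ?thesis using l by (simp add: field_simps power2_eq_square)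
qed

end

context periodic_cell
begin

section \<open>Derivatives along translations\<close>

text \<open>The identity \<open>W (x + s i) - W x = integral of G (x + \<sigma> i) over 0 \<le> \<sigma> \<le> s\<close>, tested with square integrable
functions: \<open>G\<close> is the derivative of \<open>W\<close> in direction \<open>i\<close>, including across the faces of the cell.\<close>

definition translation_derivative :: "('a \<Rightarrow> real) \<Rightarrow> ('a \<Rightarrow> real) \<Rightarrow> bool" where
  "translation_derivative W G \<longleftrightarrow> sq W \<and> sq G \<and>
     (\<forall>V s. sq V \<longrightarrow> 0 \<le> s \<longrightarrow> s \<le> L \<longrightarrow>
        ip (\<lambda>x. shift s W x - W x) V = (LINT \<sigma>|N s. ip (shift \<sigma> G) V))"

lemma space_N: "space (N s) = {0..s}"
  by (simp add: space_restrict_space)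

lemma integral_N_const: "0 \<le> s \<Longrightarrow> (LINT \<sigma>|N s. c) = s * (c::real)"
  by (simp add: measure_restrict_space space_restrict_space)

text \<open>The factor \<open>c\<close> allows translation in both directions: forwards for the derivative of \<open>W\<close>, backwards for the
test function.\<close>

lemma shift_Fubini:
  assumes P: "sq P" and Q: "sq Q" and c: "\<bar>c\<bar> \<le> 1" and s: "0 \<le> s" "s \<le> L"
  shows "integrable (N s \<Otimes>\<^sub>M M) (\<lambda>(\<sigma>, x). shift (c * \<sigma>) P x * Q x)"
proof -
  interpret N: finite_measure "N s" by (rule N_finite)
  interpret NM: pair_sigma_finite "N s" M ..
  have [measurable]: "P \<in> borel_measurable borel" "Q \<in> borel_measurable borel"
    using P Q by (auto simp: sq_def)
  have cs: "\<bar>c * \<sigma>\<bar> \<le> L" if "\<sigma> \<in> {0..s}" for \<sigma>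
    using mult_mono[OF c, of "\<bar>\<sigma>\<bar>" L] that s by (auto simp: abs_mult)
  have sqP: "sq (shift (c * \<sigma>) P)" if "\<sigma> \<in> {0..s}" for \<sigma>
    using sq_shift[OF P cs[OF that]] .
  have meas: "(\<lambda>(\<sigma>, x). shift (c * \<sigma>) P x * Q x) \<in> borel_measurable (N s \<Otimes>\<^sub>M M)"
  proof -
    have [measurable]: "id \<in> N s \<rightarrow>\<^sub>M borel" "id \<in> M \<rightarrow>\<^sub>M borel"
      by (simp_all add: measurable_restrict_space1)
    have "(\<lambda>z. P (id (snd z) + (c * id (fst z)) *\<^sub>R i) * Q (id (snd z))) \<in> borel_measurable (N s \<Otimes>\<^sub>M M)"
      by measurable
    then show ?thesis by (simp add: shift_def case_prod_beta')
  qed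
  have bound: "(LINT x|M. norm (shift (c * \<sigma>) P x * Q x)) \<le> ip P P + ip Q Q" if \<sigma>: "\<sigma> \<in> {0..s}" for \<sigma>
  proof -
    have "(LINT x|M. norm (shift (c * \<sigma>) P x * Q x)) \<le> (LINT x|M. (shift (c * \<sigma>) P x)\<^sup>2 + (Q x)\<^sup>2)"
    proof (rule integral_mono)
      fix x
      have "2 * \<bar>shift (c * \<sigma>) P x * Q x\<bar> \<le> (shift (c * \<sigma>) P x)\<^sup>2 + (Q x)\<^sup>2"
        using sum_squares_bound[of "\<bar>shift (c * \<sigma>) P x\<bar>" "\<bar>Q x\<bar>"] by (simp add: abs_mult)
      moreover have "0 \<le> \<bar>shift (c * \<sigma>) P x * Q x\<bar>" by simp
      ultimately show "norm (shift (c * \<sigma>) P x * Q x) \<le> (shift (c * \<sigma>) P x)\<^sup>2 + (Q x)\<^sup>2"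
        unfolding real_norm_def by linarith
    qed (use sq_mult_integrable[OF sqP[OF \<sigma>] Q] sqP[OF \<sigma>] Q in \<open>auto simp: sq_def\<close>)
    also have "\<dots> = ip (shift (c * \<sigma>) P) (shift (c * \<sigma>) P) + ip Q Q"
      using sqP[OF \<sigma>] Q by (simp add: ip_def sq_def power2_eq_square)
    also have "ip (shift (c * \<sigma>) P) (shift (c * \<sigma>) P) = ip P P" by (rule ip_shift[OF P P cs[OF \<sigma>]])
    finally show ?thesis .
  qed
  show ?thesis
  proof (rule NM.Fubini_integrable[OF meas])
    show "integrable (N s) (\<lambda>\<sigma>. LINT x|M. norm (case (\<sigma>, x) of (\<sigma>, x) \<Rightarrow> shift (c * \<sigma>) P x * Q x))"
    proof (rule finite_measure.integrable_const_bound[OF N_finite, where B = "ip P P + ip Q Q"])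
      show "AE \<sigma> in N s. norm (LINT x|M. norm (case (\<sigma>, x) of (\<sigma>, x) \<Rightarrow> shift (c * \<sigma>) P x * Q x)) \<le> ip P P + ip Q Q"
        using bound by (intro AE_I2) (simp add: space_N)
      show "(\<lambda>\<sigma>. LINT x|M. norm (case (\<sigma>, x) of (\<sigma>, x) \<Rightarrow> shift (c * \<sigma>) P x * Q x)) \<in> borel_measurable (N s)"
        using meas by (intro M.borel_measurable_lebesgue_integral borel_measurable_norm) (simp add: case_prod_beta')
    qed
    show "AE \<sigma> in N s. integrable M (\<lambda>x. case (\<sigma>, x) of (\<sigma>, x) \<Rightarrow> shift (c * \<sigma>) P x * Q x)"
      using sq_mult_integrable[OF sqP Q] by (intro AE_I2) (simp add: space_N)
  qed
qed

lemma
  assumes P: "sq P" and Q: "sq Q" and c: "\<bar>c\<bar> \<le> 1" and s: "0 \<le> s" "s \<le> L"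
  shows integrable_ip_shift: "integrable (N s) (\<lambda>\<sigma>. ip (shift (c * \<sigma>) P) Q)"
    and integrable_shift_average: "integrable M (\<lambda>x. (LINT \<sigma>|N s. shift (c * \<sigma>) P x) * Q x)"
    and ip_shift_average: "(LINT x|M. (LINT \<sigma>|N s. shift (c * \<sigma>) P x) * Q x) = (LINT \<sigma>|N s. ip (shift (c * \<sigma>) P) Q)"
proof -
  interpret N: finite_measure "N s" by (rule N_finite)
  interpret NM: pair_sigma_finite "N s" M ..
  note I = shift_Fubini[OF assms]
  show "integrable (N s) (\<lambda>\<sigma>. ip (shift (c * \<sigma>) P) Q)"
    using NM.integrable_fst[OF I] by (simp add: ip_def)
  show "integrable M (\<lambda>x. (LINT \<sigma>|N s. shift (c * \<sigma>) P x) * Q x)"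
    using NM.integrable_snd[OF I] by simp
  show "(LINT x|M. (LINT \<sigma>|N s. shift (c * \<sigma>) P x) * Q x) = (LINT \<sigma>|N s. ip (shift (c * \<sigma>) P) Q)"
    using NM.Fubini_integral[OF I] by (simp add: ip_def)
qed

text \<open>Test the defining identity with the increment of \<open>W\<close> itself and absorb half of its square by Young's
inequality with parameter \<open>s\<close>.\<close>

lemma translation_lipschitz:
  assumes W: "translation_derivative W G" and s: "0 \<le> s" "s \<le> L"
  shows "ip (\<lambda>x. shift s W x - W x) (\<lambda>x. shift s W x - W x) \<le> s\<^sup>2 * ip G G"
proof (cases "s = 0")
  case True
  then show ?thesis by (simp add: ip_def shift_def)
next
  case False
  with s have s0: "0 < s" by simp
  let ?X = "\<lambda>x. shift s W x - W x"
  have sqs: "sq W" "sq G" using W by (auto simp: translation_derivative_def)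
  have X: "sq ?X" using s sqs by (intro sq_diff sq_shift) auto
  have "ip ?X ?X = (LINT \<sigma>|N s. ip (shift \<sigma> G) ?X)"
    using W X s by (simp add: translation_derivative_def)
  also have "\<dots> \<le> (LINT \<sigma>|N s. s / 2 * ip G G + 1 / (2 * s) * ip ?X ?X)"
  proof (rule integral_mono)
    show "integrable (N s) (\<lambda>\<sigma>. ip (shift \<sigma> G) ?X)"
      using integrable_ip_shift[OF sqs(2) X, of 1 s] s by simp
    show "integrable (N s) (\<lambda>\<sigma>. s / 2 * ip G G + 1 / (2 * s) * ip ?X ?X)"
      by (rule finite_measure.integrable_const[OF N_finite])
    fix \<sigma> assume "\<sigma> \<in> space (N s)"
    then have \<sigma>: "\<bar>\<sigma>\<bar> \<le> L" using s by (simp add: space_N)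
    show "ip (shift \<sigma> G) ?X \<le> s / 2 * ip G G + 1 / (2 * s) * ip ?X ?X"
      using ip_young[OF sq_shift[OF sqs(2) \<sigma>] X s0] ip_shift[OF sqs(2) sqs(2) \<sigma>] by simp
  qed
  also have "\<dots> = s\<^sup>2 / 2 * ip G G + ip ?X ?X / 2"
    using s0 by (subst integral_N_const) (auto simp: field_simps power2_eq_square)
  finally show ?thesis by simp
qed

text \<open>The inner product of the moved \<open>G\<close> with \<open>V\<close> may be compared with the one of \<open>G\<close> and \<open>V\<close> by moving \<open>V\<close>
instead, which is Lipschitz continuous because \<open>V\<close> has a derivative; \<open>G\<close> itself is merely square
integrable.\<close>

lemma translation_quotient:
  assumes W: "translation_derivative W G" and V: "translation_derivative V H" and s: "0 < s" "s \<le> L"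
  shows "\<bar>ip (\<lambda>x. shift s W x - W x) V - s * ip G V\<bar> \<le> s\<^sup>2 / 2 * (ip G G + ip H H)"
proof -
  have sqs: "sq W" "sq G" "sq V" "sq H" using W V by (auto simp: translation_derivative_def)
  have int: "integrable (N s) (\<lambda>\<sigma>. ip (shift \<sigma> G) V)"
    using integrable_ip_shift[OF sqs(2,3), of 1 s] s by simp
  have intc: "integrable (N s) (\<lambda>\<sigma>. c::real)" for c
    by (rule finite_measure.integrable_const[OF N_finite])
  have "ip (\<lambda>x. shift s W x - W x) V - s * ip G V = (LINT \<sigma>|N s. ip (shift \<sigma> G) V - ip G V)"
  proof -
    have "ip (\<lambda>x. shift s W x - W x) V = (LINT \<sigma>|N s. ip (shift \<sigma> G) V)"
      using W sqs(3) s by (simp add: translation_derivative_def)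
    then show ?thesis
      unfolding Bochner_Integration.integral_diff[OF int intc] using s by (subst integral_N_const) auto
  qed
  also have "\<bar>\<dots>\<bar> \<le> (LINT \<sigma>|N s. \<bar>ip (shift \<sigma> G) V - ip G V\<bar>)"
    by (rule integral_abs_bound)
  also have "\<dots> \<le> (LINT \<sigma>|N s. s / 2 * (ip G G + ip H H))"
  proof (rule integral_mono)
    show "integrable (N s) (\<lambda>\<sigma>. \<bar>ip (shift \<sigma> G) V - ip G V\<bar>)" using int intc[of "ip G V"] by simp
    show "integrable (N s) (\<lambda>\<sigma>. s / 2 * (ip G G + ip H H))" by (rule intc)
    fix \<sigma> assume "\<sigma> \<in> space (N s)"
    then have \<sigma>: "0 \<le> \<sigma>" "\<sigma> \<le> s" "\<bar>\<sigma>\<bar> \<le> L" using s by (auto simp: space_N)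
    let ?X = "\<lambda>x. shift \<sigma> V x - V x"
    have X: "sq ?X" using sqs \<sigma> by (intro sq_diff sq_shift)
    have G\<sigma>: "sq (shift \<sigma> G)" using sqs(2) \<sigma>(3) by (rule sq_shift)
    have "ip G V = ip (shift \<sigma> G) (shift \<sigma> V)" using ip_shift[OF sqs(2,3) \<sigma>(3)] by simp
    then have "ip (shift \<sigma> G) V - ip G V = - ip (shift \<sigma> G) ?X"
      using ip_diff[OF sq_shift[OF sqs(3) \<sigma>(3)] sqs(3) G\<sigma>] by (simp add: ip_commute)
    then have "\<bar>ip (shift \<sigma> G) V - ip G V\<bar> \<le> s / 2 * ip G G + 1 / (2 * s) * ip ?X ?X"
      using ip_young[OF G\<sigma> X s(1)] ip_shift[OF sqs(2) sqs(2) \<sigma>(3)] by simp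
    also have "ip ?X ?X \<le> \<sigma>\<^sup>2 * ip H H"
      using translation_lipschitz[OF V, of \<sigma>] \<sigma> by simp
    also have "\<sigma>\<^sup>2 * ip H H \<le> s\<^sup>2 * ip H H"
      using \<sigma> s by (intro mult_right_mono power_mono ip_nonneg)
    finally show "\<bar>ip (shift \<sigma> G) V - ip G V\<bar> \<le> s / 2 * (ip G G + ip H H)"
      using s(1) by (simp add: field_simps power2_eq_square)
  qed
  also have "\<dots> = s\<^sup>2 / 2 * (ip G G + ip H H)"
    using s by (subst integral_N_const) (auto simp: power2_eq_square)
  finally show ?thesis .
qed

text \<open>The inner product of \<open>W\<close> and \<open>V\<close> does not change when both are moved by \<open>s\<close>. Its first order variation is
\<open>s * (ip G V + ip W H)\<close>, and all remaining terms are of order \<open>s\<^sup>2\<close>.\<close>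

lemma translation_derivative_skew:
  assumes W: "translation_derivative W G" and V: "translation_derivative V H"
  shows "ip G V + ip W H = 0"
proof -
  have sqs: "sq W" "sq G" "sq V" "sq H" using W V by (auto simp: translation_derivative_def)
  define E where "E = ip G G + ip H H"
  define K where "K = ip G V + ip W H"
  have bound: "\<bar>K\<bar> \<le> 3 / 2 * E * s" if s: "0 < s" "s \<le> L" for s
  proof -
    let ?X = "\<lambda>x. shift s W x - W x" and ?Y = "\<lambda>x. shift s V x - V x"
    have sL: "\<bar>s\<bar> \<le> L" using s by simp
    have Ws: "sq (shift s W)" and Vs: "sq (shift s V)" using sqs sL by (auto intro: sq_shift)
    have X: "sq ?X" and Y: "sq ?Y" using sqs Ws Vs by (auto intro: sq_diff)
    have "ip ?X ?Y = ip (shift s W) ?Y - ip W ?Y" by (rule ip_diff[OF Ws sqs(1) Y])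
    also have "\<dots> = ip ?Y (shift s W) - ip ?Y W" by (simp add: ip_commute)
    also have "ip ?Y (shift s W) = ip W V - ip V (shift s W)"
      using ip_diff[OF Vs sqs(3) Ws] ip_shift[OF sqs(3) sqs(1) sL] by (simp add: ip_commute)
    also have "ip V (shift s W) = ip ?X V + ip W V"
      using ip_diff[OF Ws sqs(1,3)] by (simp add: ip_commute)
    finally have XY: "ip ?X ?Y = - (ip ?X V + ip ?Y W)" by simp
    \<comment> \<open>Both increments are of order \<open>s\<close>, so their inner product is of order \<open>s\<^sup>2\<close>.\<close>
    have "\<bar>ip ?X ?Y\<bar> \<le> 1 / 2 * ip ?X ?X + 1 / 2 * ip ?Y ?Y"
      using ip_young[OF X Y, of 1] by simp
    also have "\<dots> \<le> s\<^sup>2 / 2 * E"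
      using translation_lipschitz[OF W, of s] translation_lipschitz[OF V, of s] s
      by (simp add: E_def algebra_simps)
    finally have "\<bar>ip ?X V + ip ?Y W\<bar> \<le> s\<^sup>2 / 2 * E" unfolding XY abs_minus_cancel .
    moreover have "\<bar>ip ?X V - s * ip G V\<bar> \<le> s\<^sup>2 / 2 * E"
      unfolding E_def by (rule translation_quotient[OF W V s])
    moreover have "\<bar>ip ?Y W - s * ip W H\<bar> \<le> s\<^sup>2 / 2 * E"
      using translation_quotient[OF V W s] by (simp add: E_def ip_commute add.commute)
    ultimately have "\<bar>s * K\<bar> \<le> 3 * (s\<^sup>2 / 2 * E)"
      unfolding K_def distrib_left by linarith
    then show ?thesis using s(1) by (simp add: abs_mult power2_eq_square field_simps)
  qed
  have "((\<lambda>s. 3 / 2 * E * s) \<longlongrightarrow> 3 / 2 * E * 0) (at_right 0)"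
    by (intro tendsto_intros)
  then have "\<bar>K\<bar> \<le> 3 / 2 * E * 0"
    by (rule tendsto_lowerbound) (use bound L_pos in \<open>auto simp: eventually_at_right_field\<close>)
  then show ?thesis by (simp add: K_def)
qed

end

section \<open>Weak derivatives of periodic functions\<close>

text \<open>The bound on \<open>y\<close> keeps it away from the next period, where the cosine is large again.\<close>

lemma cos_gt_cos_iff:
  fixes y t :: real
  assumes t: "0 < t" "t < pi" and y: "\<bar>y\<bar> < 2 * pi - t"
  shows "cos t < cos y \<longleftrightarrow> \<bar>y\<bar> < t"
proof (cases "\<bar>y\<bar> \<le> pi")
  case True
  have "cos y = cos \<bar>y\<bar>" by simp
  with True t show ?thesis using cos_mono_less_eq[of t "\<bar>y\<bar>"] by simp
next
  case False
  have "cos y = cos (2 * pi - \<bar>y\<bar>)" by (simp add: cos_diff)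
  moreover have "cos (2 * pi - \<bar>y\<bar>) \<le> cos t"
    using False t y by (intro cos_monotone_0_pi_le) auto
  ultimately show ?thesis using False t by auto
qed

text \<open>On one period, the cosine centred at the midpoint of an interval exceeds its value at the end points exactly
inside the interval.\<close>

lemma periodic_bump_exists:
  fixes a b c d :: "'a::euclidean_space"
  assumes cd: "box c d \<noteq> {}" "cbox c d \<subseteq> box a b"
  obtains q where "\<And>j. j \<in> Basis \<Longrightarrow> smooth (q j)" "\<And>m. box_periodic a b (bump q m)"
    "\<And>x. x \<in> box a b \<Longrightarrow> x \<in> box c d \<longleftrightarrow> (\<forall>j\<in>Basis. 0 < q j x)"
proof -
  have ord: "a \<bullet> j < c \<bullet> j" "c \<bullet> j < d \<bullet> j" "d \<bullet> j < b \<bullet> j" if "j \<in> Basis" for j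
  proof -
    show cdj: "c \<bullet> j < d \<bullet> j" using cd(1) that by (simp add: box_ne_empty)
    have "c \<in> cbox c d" "d \<in> cbox c d"
      using cd(1) by (auto simp: box_ne_empty mem_box less_imp_le)
    with cd(2) that show "a \<bullet> j < c \<bullet> j" "d \<bullet> j < b \<bullet> j" by (auto simp: mem_box subset_eq)
  qed
  \<comment> \<open>\<open>w j\<close> is the angular frequency of the period in direction \<open>j\<close>, and \<open>t j\<close> half the width of the interval as an angle.\<close>
  define w where "w j = 2 * pi / ((b - a) \<bullet> j)" for j
  define t where "t j = w j * ((d - c) \<bullet> j) / 2" for j
  define q where "q j x = cos ((w j *\<^sub>R j) \<bullet> x + (- (w j * ((c + d) \<bullet> j) / 2))) + (- cos (t j))" for j x
  show thesis
  proof
    show "smooth (q j)" for j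
      unfolding q_def by (intro smooth_add smooth_cos_affine smooth_const)
    show "box_periodic a b (bump q m)" for m
      unfolding box_periodic_def
    proof (intro allI ballI)
      fix x k :: 'a assume k: "k \<in> Basis"
      have "q j (x + ((b - a) \<bullet> k) *\<^sub>R k) = q j x" if j: "j \<in> Basis" for j
      proof (cases "j = k")
        case True
        have "w k * ((b - a) \<bullet> k) = 2 * pi" using ord[OF k] by (simp add: w_def inner_diff_left)
        then have "(w k *\<^sub>R k) \<bullet> (x + ((b - a) \<bullet> k) *\<^sub>R k) = (w k *\<^sub>R k) \<bullet> x + 2 * pi"
          using k by (simp add: inner_add_right mult.commute)
        then have "(w k *\<^sub>R k) \<bullet> (x + ((b - a) \<bullet> k) *\<^sub>R k) + r = ((w k *\<^sub>R k) \<bullet> x + r) + 2 * pi" for r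
          by simp
        then show ?thesis unfolding q_def True by (simp only: cos_periodic)
      next
        case False
        then show ?thesis using j k by (simp add: q_def inner_add_right inner_Basis)
      qed
      then show "bump q m (x + ((b - a) \<bullet> k) *\<^sub>R k) = bump q m x"
        unfolding bump_def by (intro prod.cong) simp_all
    qed
    show "x \<in> box c d \<longleftrightarrow> (\<forall>j\<in>Basis. 0 < q j x)" if x: "x \<in> box a b" for x
    proof -
      have "0 < q j x \<longleftrightarrow> c \<bullet> j < x \<bullet> j \<and> x \<bullet> j < d \<bullet> j" if j: "j \<in> Basis" for j
      proof -
        note o = ord[OF j]
        have xj: "a \<bullet> j < x \<bullet> j" "x \<bullet> j < b \<bullet> j" using x j by (auto simp: mem_box)
        have w: "0 < w j" "w j * (b \<bullet> j - a \<bullet> j) = 2 * pi"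
          using o by (auto simp: w_def inner_diff_left)
        define y where "y = w j * (x \<bullet> j - (c \<bullet> j + d \<bullet> j) / 2)"
        have ay: "\<bar>y\<bar> = w j * \<bar>x \<bullet> j - (c \<bullet> j + d \<bullet> j) / 2\<bar>" using w by (simp add: y_def abs_mult)
        have t: "t j = w j * ((d \<bullet> j - c \<bullet> j) / 2)" by (simp add: t_def inner_diff_left)
        have t0: "0 < t j" using w o by (simp add: t)
        have "t j < w j * ((b \<bullet> j - a \<bullet> j) / 2)"
          unfolding t using o w by (intro mult_strict_left_mono) auto
        then have tpi: "t j < pi" using w(2) by simp
        have "\<bar>y\<bar> < w j * ((b \<bullet> j - a \<bullet> j) - (d \<bullet> j - c \<bullet> j) / 2)"
          unfolding ay using xj o w by (intro mult_strict_left_mono) (auto simp: abs_if field_simps)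
        then have y: "\<bar>y\<bar> < 2 * pi - t j" using w(2) by (simp add: t right_diff_distrib)
        have "0 < q j x \<longleftrightarrow> cos (t j) < cos y"
          by (simp add: q_def y_def inner_commute inner_add_left algebra_simps add_divide_distrib)
        also have "\<dots> \<longleftrightarrow> \<bar>y\<bar> < t j" by (rule cos_gt_cos_iff[OF t0 tpi y])
        also have "\<dots> \<longleftrightarrow> \<bar>x \<bullet> j - (c \<bullet> j + d \<bullet> j) / 2\<bar> < (d \<bullet> j - c \<bullet> j) / 2"
          unfolding ay t using w by simp
        also have "\<dots> \<longleftrightarrow> c \<bullet> j < x \<bullet> j \<and> x \<bullet> j < d \<bullet> j" by (auto simp: abs_if field_simps)
        finally show ?thesis .
      qed
      then show ?thesis by (simp add: mem_box)
    qed
  qed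
qed

context periodic_cell
begin

lemma cell_box_null: "AE x in lborel. x \<in> cell \<longleftrightarrow> x \<in> box a b"
proof -
  have "AE x in lborel. x \<notin> cbox a b - box a b"
    using negligible_frontier_interval[of a b]
    by (intro AE_not_in) (simp add: negligible_iff_null_sets null_sets_completion_iff)
  then show ?thesis
    by eventually_elim (auto simp: cell_def mem_box less_imp_le)
qed

lemma
  fixes f :: "'a \<Rightarrow> real"
  assumes f[measurable]: "f \<in> borel_measurable borel"
  shows integrable_box_iff: "integrable (lebesgue_on (box a b)) f \<longleftrightarrow> integrable M f"
    and integral_box_eq: "(LINT x|lebesgue_on (box a b). f x) = (LINT x|M. f x)"
proof -
  have AE: "AE x in lborel. indicator (box a b) x *\<^sub>R f x = indicator cell x *\<^sub>R f x"
    using cell_box_null by eventually_elim (auto simp: indicator_def)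
  have "integrable (lebesgue_on (box a b)) f \<longleftrightarrow> integrable lborel (\<lambda>x. indicator (box a b) x *\<^sub>R f x)"
    by (simp add: integrable_restrict_space integrable_completion)
  also have "\<dots> \<longleftrightarrow> integrable lborel (\<lambda>x. indicator cell x *\<^sub>R f x)"
    by (rule integrable_cong_AE[OF _ _ AE]) measurable
  also have "\<dots> \<longleftrightarrow> integrable M f" by (simp add: integrable_restrict_space)
  finally show "integrable (lebesgue_on (box a b)) f \<longleftrightarrow> integrable M f" .
  have "(LINT x|lebesgue_on (box a b). f x) = (LINT x|lborel. indicator (box a b) x *\<^sub>R f x)"
    by (simp add: integral_restrict_space integral_completion)
  also have "\<dots> = (LINT x|lborel. indicator cell x *\<^sub>R f x)"
    by (rule integral_cong_AE[OF _ _ AE]) measurable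
  also have "\<dots> = (LINT x|M. f x)" by (simp add: integral_restrict_space)
  finally show "(LINT x|lebesgue_on (box a b). f x) = (LINT x|M. f x)" .
qed

lemma sq_in_L2:
  assumes "sq P" shows "P \<in> L2 (box a b)"
proof -
  have P: "P \<in> borel_measurable borel" using assms by (simp add: sq_def)
  then have "P \<in> borel_measurable (lebesgue_on (box a b))"
    by (intro measurable_restrict_space1 measurable_completion) simp
  moreover have "integrable (lebesgue_on (box a b)) (\<lambda>x. (P x)\<^sup>2)"
    using integrable_box_iff[of "\<lambda>x. (P x)\<^sup>2"] P assms by (simp add: sq_def)
  ultimately show ?thesis by (simp add: L2_def)
qed

lemma l2_inner_eq_ip: "sq P \<Longrightarrow> sq Q \<Longrightarrow> l2_inner (box a b) P Q = ip P Q"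
  unfolding l2_inner_def ip_def inner_real_def
  by (intro integral_box_eq borel_measurable_times) (auto simp: sq_def)

lemma smooth_periodic_sq:
  assumes "smooth \<psi>" "periodic \<psi>" shows "sq \<psi>"
proof -
  have m: "\<psi> \<in> borel_measurable borel"
    using smooth_continuous_on[OF assms(1)] by (rule borel_measurable_continuous_onI)
  have "\<psi> \<in> L2 (box a b)" by (rule smooth_in_L2[OF _ _ assms(1)]) auto
  then show ?thesis using m assms(2) integrable_box_iff[of "\<lambda>x. (\<psi> x)\<^sup>2"] by (simp add: sq_def L2_def)
qed

lemma box_periodic_imp_periodic: "box_periodic a b \<psi> \<Longrightarrow> periodic \<psi>"
  using i by (simp add: box_periodic_def periodic_def shift_def L_def fun_eq_iff)

text \<open>Only the values on the open box matter: a Borel representative there is continued periodically in direction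
\<open>i\<close>.\<close>

lemma L2_periodic_representative:
  assumes f: "f \<in> L2 (box a b)"
  obtains P where "sq P" "AE x in lebesgue_on (box a b). f x = P x"
proof -
  have "(\<lambda>x. indicator (box a b) x * f x) \<in> borel_measurable lebesgue"
    using f by (simp add: L2_def borel_measurable_restrict_space_iff)
  then obtain g where g[measurable]: "g \<in> borel_measurable lborel"
    and fg: "AE x in lborel. indicator (box a b) x * f x = g x"
    using completion_ex_borel_measurable_real by blast
  define P where "P x = g (wrap x)" for x
  have g': "g \<in> borel_measurable borel" using g by simp
  have P_meas: "P \<in> borel_measurable borel"
    unfolding P_def[abs_def] by (rule measurable_compose[OF wrap_measurable g'])
  have "AE x in lebesgue. indicator (box a b) x * f x = g x" using fg by (rule AE_completion)
  then have AE: "AE x in lebesgue_on (box a b). f x = P x"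
  proof (subst AE_restrict_space_iff, goal_cases)
    case 2
    then show ?case
    proof eventually_elim
      case (elim x)
      show ?case
      proof
        assume x: "x \<in> box a b"
        then have "x \<in> cell" by (auto simp: cell_def mem_box less_imp_le)
        with elim x show "f x = P x" by (simp add: P_def wrap_cell)
      qed
    qed
  qed simp
  have "integrable (lebesgue_on (box a b)) (\<lambda>x. (P x)\<^sup>2)"
  proof (subst integrable_cong_AE)
    show "AE x in lebesgue_on (box a b). (P x)\<^sup>2 = (f x)\<^sup>2" using AE by eventually_elim simp
    show "(\<lambda>x. (P x)\<^sup>2) \<in> borel_measurable (lebesgue_on (box a b))"
      using P_meas by (intro measurable_restrict_space1 measurable_completion) simp
  qed (use f in \<open>auto simp: L2_def\<close>)
  then have "sq P"
    using integrable_box_iff[of "\<lambda>x. (P x)\<^sup>2"] P_meas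
    by (simp add: sq_def periodic_def shift_def fun_eq_iff P_def wrap_periodic)
  with AE show thesis using that by blast
qed

text \<open>For a smooth periodic \<open>\<psi>\<close>, the increment of \<open>W\<close> tested with \<open>\<psi>\<close> is \<open>W\<close> tested with the backward increment of
\<open>\<psi>\<close>, which is an integral of translates of its derivative; the weak formulation turns these into \<open>G\<close> tested with
translates of \<open>\<psi>\<close>. Hence \<open>D\<close>, the defect in the identity, is orthogonal to all periodic bumps and vanishes almost
everywhere, so every square integrable \<open>V\<close> is an admissible test function.\<close>

lemma weak_periodic_imp_translation_derivative:
  assumes W: "sq W" and G: "sq G"
    and weak: "\<And>\<psi>. smooth \<psi> \<Longrightarrow> box_periodic a b \<psi> \<Longrightarrow>
      ip W (\<lambda>x. frechet_derivative \<psi> (at x) i) = - ip G \<psi>"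
  shows "translation_derivative W G"
  unfolding translation_derivative_def
proof (intro conjI allI impI W G)
  fix V s assume V: "sq V" and s: "0 \<le> s" "s \<le> L"
  have sL: "\<bar>s\<bar> \<le> L" "\<bar>-s\<bar> \<le> L" using s by auto
  \<comment> \<open>The factor 1 is the direction parameter of the lemmas on averaged translates.\<close>
  define D where "D x = shift s W x - W x - (LINT \<sigma>|N s. shift (1 * \<sigma>) G x)" for x
  have Ws: "sq (shift s W)" using sq_shift[OF W] s by simp
  have intD: "integrable M (\<lambda>x. D x * Q x)"
    and ipD: "(LINT x|M. D x * Q x) = ip (\<lambda>x. shift s W x - W x) Q - (LINT \<sigma>|N s. ip (shift \<sigma> G) Q)"
    if Q: "sq Q" for Q
  proof -
    note A = sq_mult_integrable[OF sq_diff[OF Ws W] Q] integrable_shift_average[OF G Q _ s, of 1]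
    have *: "D x * Q x = (shift s W x - W x) * Q x - (LINT \<sigma>|N s. shift (1 * \<sigma>) G x) * Q x" for x
      by (simp add: D_def left_diff_distrib)
    show "integrable M (\<lambda>x. D x * Q x)" unfolding * using A by (intro Bochner_Integration.integrable_diff) auto
    show "(LINT x|M. D x * Q x) = ip (\<lambda>x. shift s W x - W x) Q - (LINT \<sigma>|N s. ip (shift \<sigma> G) Q)"
      unfolding * using A ip_shift_average[OF G Q _ s, of 1]
      by (subst Bochner_Integration.integral_diff) (auto simp: ip_def)
  qed
  have test: "(LINT x|M. D x * \<psi> x) = 0" if \<psi>: "smooth \<psi>" "box_periodic a b \<psi>" for \<psi>
  proof -
    note per = box_periodic_imp_periodic[OF \<psi>(2)]
    note sq\<psi> = smooth_periodic_sq[OF \<psi>(1) per]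
    define d where "d x = frechet_derivative \<psi> (at x) i" for x
    have translate: "frechet_derivative (\<lambda>x. \<psi> (x + c)) (at x) = frechet_derivative \<psi> (at (x + c))" for c x
      by (rule frechet_derivative_translate[OF smooth_differentiable[OF \<psi>(1)]])
    have sm_d: "smooth d" unfolding d_def[abs_def] by (rule smooth_frechet[OF \<psi>(1) i])
    have "(\<lambda>x. \<psi> (x + L *\<^sub>R i)) = \<psi>" using periodicD[OF per] by auto
    then have "periodic d" using translate[of "L *\<^sub>R i"] by (simp add: periodic_def shift_def fun_eq_iff d_def)
    then have sqd: "sq d" by (rule smooth_periodic_sq[OF sm_d])
    have FTC: "(LINT \<sigma>|N s. shift ((-1) * \<sigma>) d x) = \<psi> x - shift (-s) \<psi> x" for x
    proof -
      have der: "((\<lambda>\<sigma>. - \<psi> (x + (- \<sigma>) *\<^sub>R i)) has_vector_derivative d (x + (- \<sigma>) *\<^sub>R i)) (at \<sigma> within {0..s})" for \<sigma>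
      proof -
        let ?D = "frechet_derivative \<psi> (at (x + (- \<sigma>) *\<^sub>R i))"
        have "(\<psi> has_derivative ?D) (at (x + (- \<sigma>) *\<^sub>R i))"
          using smooth_differentiable[OF \<psi>(1)] by (simp add: frechet_derivative_works[symmetric])
        then have "((\<lambda>\<sigma>. \<psi> (x + (- \<sigma>) *\<^sub>R i)) has_derivative (\<lambda>h. ?D ((- h) *\<^sub>R i))) (at \<sigma> within {0..s})"
          by (rule has_derivative_compose[rotated]) (auto intro!: derivative_eq_intros)
        then have "((\<lambda>\<sigma>. - \<psi> (x + (- \<sigma>) *\<^sub>R i)) has_derivative (\<lambda>h. - ?D ((- h) *\<^sub>R i))) (at \<sigma> within {0..s})"
          by (rule has_derivative_minus)
        moreover have "- ?D ((- h) *\<^sub>R i) = h *\<^sub>R d (x + (- \<sigma>) *\<^sub>R i)" for h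
        proof -
          have "?D ((- h) *\<^sub>R i) = (- h) *\<^sub>R ?D i"
            by (rule linear_scale[OF linear_frechet_derivative[OF smooth_differentiable[OF \<psi>(1)]]])
          then show ?thesis by (simp only: d_def scaleR_minus_left minus_minus)
        qed
        ultimately show ?thesis by (simp add: has_vector_derivative_def)
      qed
      have "(LINT \<sigma>|N s. shift ((-1) * \<sigma>) d x) = (LINT \<sigma>|lborel. indicator {0..s} \<sigma> *\<^sub>R d (x + (- \<sigma>) *\<^sub>R i))"
        by (simp add: integral_restrict_space shift_def)
      also have "\<dots> = - \<psi> (x + (- s) *\<^sub>R i) - - \<psi> (x + (- 0) *\<^sub>R i)"
        by (rule integral_FTC_Icc[OF s(1) der])
           (intro continuous_on_compose2[OF smooth_continuous_on[OF sm_d, of UNIV]] continuous_intros subset_UNIV)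
      finally show ?thesis by (simp add: shift_def)
    qed
    have weak': "ip W (shift ((-1) * \<sigma>) d) = - ip (shift \<sigma> G) \<psi>" if "\<sigma> \<in> {0..s}" for \<sigma>
    proof -
      have \<sigma>: "\<bar>\<sigma>\<bar> \<le> L" "\<bar>- \<sigma>\<bar> \<le> L" using that s by auto
      have "box_periodic a b (\<lambda>x. \<psi> (x + (- \<sigma>) *\<^sub>R i))"
        unfolding box_periodic_def
      proof (intro allI ballI)
        fix x k :: 'a assume "k \<in> Basis"
        then have "\<psi> (x + (- \<sigma>) *\<^sub>R i + ((b - a) \<bullet> k) *\<^sub>R k) = \<psi> (x + (- \<sigma>) *\<^sub>R i)"
          using \<psi>(2) unfolding box_periodic_def by blast
        then show "\<psi> (x + ((b - a) \<bullet> k) *\<^sub>R k + (- \<sigma>) *\<^sub>R i) = \<psi> (x + (- \<sigma>) *\<^sub>R i)"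
          by (simp only: add.assoc add.commute[of "((b - a) \<bullet> k) *\<^sub>R k"])
      qed
      then have "ip W (\<lambda>x. frechet_derivative (\<lambda>x. \<psi> (x + (- \<sigma>) *\<^sub>R i)) (at x) i) = - ip G (\<lambda>x. \<psi> (x + (- \<sigma>) *\<^sub>R i))"
        by (intro weak smooth_translate \<psi>)
      then have "ip W (shift ((-1) * \<sigma>) d) = - ip G (shift (- \<sigma>) \<psi>)"
        unfolding translate by (simp add: shift_def[abs_def] d_def)
      also have "ip G (shift (- \<sigma>) \<psi>) = ip (shift \<sigma> G) (shift \<sigma> (shift (- \<sigma>) \<psi>))"
        by (rule ip_shift[OF G sq_shift[OF sq\<psi> \<sigma>(2)] \<sigma>(1), symmetric])
      also have "shift \<sigma> (shift (- \<sigma>) \<psi>) = \<psi>" unfolding shift_shift by (simp add: shift_def[abs_def])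
      finally show ?thesis .
    qed
    have "ip (\<lambda>x. shift s W x - W x) \<psi> = ip (shift s W) \<psi> - ip W \<psi>" by (rule ip_diff[OF Ws W sq\<psi>])
    also have "ip (shift s W) \<psi> = ip (shift s W) (shift s (shift (- s) \<psi>))"
      unfolding shift_shift by (simp add: shift_def[abs_def])
    also have "\<dots> = ip W (shift (- s) \<psi>)"
      by (rule ip_shift[OF W sq_shift[OF sq\<psi> sL(2)] sL(1)])
    also have "\<dots> - ip W \<psi> = - (LINT x|M. (LINT \<sigma>|N s. shift ((-1) * \<sigma>) d x) * W x)"
      unfolding FTC using ip_diff[OF sq\<psi> sq_shift[OF sq\<psi> sL(2)] W]
      by (simp add: ip_def mult.commute)
    also have "\<dots> = - (LINT \<sigma>|N s. ip W (shift ((-1) * \<sigma>) d))"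
      using ip_shift_average[OF sqd W _ s, of "-1"] by (simp add: ip_commute[of W])
    also have "\<dots> = - (LINT \<sigma>|N s. - ip (shift \<sigma> G) \<psi>)"
      using weak' by (intro arg_cong[where f = uminus] Bochner_Integration.integral_cong) (auto simp: space_N)
    finally show ?thesis using ipD[OF sq\<psi>] by simp
  qed
  have D_meas: "D \<in> borel_measurable borel"
  proof -
    interpret N: finite_measure "N s" by (rule N_finite)
    have [measurable]: "W \<in> borel_measurable borel" "shift s W \<in> borel_measurable borel"
        "G \<in> borel_measurable borel"
      using W G Ws by (auto simp: sq_def)
    have [measurable]: "id \<in> N s \<rightarrow>\<^sub>M borel" by (simp add: measurable_restrict_space1)
    have "(\<lambda>z. G (fst z + id (snd z) *\<^sub>R i)) \<in> borel_measurable (borel \<Otimes>\<^sub>M N s)"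
      by measurable
    then have "(\<lambda>(x, \<sigma>). shift (1 * \<sigma>) G x) \<in> borel_measurable (borel \<Otimes>\<^sub>M N s)"
      by (simp add: shift_def case_prod_beta')
    then have "(\<lambda>x. LINT \<sigma>|N s. shift (1 * \<sigma>) G x) \<in> borel_measurable borel"
      by (rule N.borel_measurable_lebesgue_integral)
    then show ?thesis unfolding D_def[abs_def] by measurable
  qed
  have "AE x in lebesgue_on (box a b). D x = 0"
  proof (rule AE_zero_of_bump_integrals)
    show "integrable (lebesgue_on (box a b)) D"
      using intD[OF sq_const[of 1]] integrable_box_iff[OF D_meas] by simp
    fix c d :: 'a assume "box c d \<noteq> {}" "cbox c d \<subseteq> box a b"
    then obtain q where q: "\<And>j. j \<in> Basis \<Longrightarrow> smooth (q j)" "\<And>m. box_periodic a b (bump q m)"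
      "\<And>x. x \<in> box a b \<Longrightarrow> x \<in> box c d \<longleftrightarrow> (\<forall>j\<in>Basis. 0 < q j x)"
      using periodic_bump_exists by blast
    have "(LINT x|lebesgue_on (box a b). D x * bump q m x) = 0" for m
    proof -
      have "bump q m \<in> borel_measurable borel"
        using smooth_continuous_on[OF smooth_bump[OF q(1)]] by (rule borel_measurable_continuous_onI)
      then have "(LINT x|lebesgue_on (box a b). D x * bump q m x) = (LINT x|M. D x * bump q m x)"
        using D_meas by (intro integral_box_eq) simp
      then show ?thesis using test[OF smooth_bump[OF q(1)] q(2)] by simp
    qed
    with q show "\<exists>q. (\<forall>j\<in>Basis. smooth (q j)) \<and> (\<forall>x\<in>box a b. (x \<in> box c d) = (\<forall>j\<in>Basis. 0 < q j x)) \<and>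
          (\<forall>m. (LINT x|lebesgue_on (box a b). D x * bump q m x) = 0)"
      by blast
  qed (rule open_box)
  then have "(LINT x|lebesgue_on (box a b). D x * V x) = 0"
    by (intro integral_eq_zero_AE) (auto elim: eventually_mono)
  then have "(LINT x|M. D x * V x) = 0"
    using D_meas V by (subst integral_box_eq[symmetric]) (auto simp: sq_def)
  then show "ip (\<lambda>x. shift s W x - W x) V = (LINT \<sigma>|N s. ip (shift \<sigma> G) V)"
    using ipD[OF V] by simp
qed

end

text \<open>Equal traces are expressed by smooth test functions; the skew-symmetry of translation derivatives extends this
to pairs of functions of class \<open>H1\<close> that both have periodic traces.\<close>

lemma periodic_integration_by_parts:
  fixes a b i :: "'a::euclidean_space"
  assumes i: "i \<in> Basis" and w: "w \<in> H1 (box a b)" "periodic_traces a b w"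
    and v: "v \<in> H1 (box a b)" "periodic_traces a b v"
  shows "l2_inner (box a b) (weak_partial (box a b) i w) v = - l2_inner (box a b) w (weak_partial (box a b) i v)"
proof (cases "box a b = {}")
  case True
  then show ?thesis by (simp add: l2_inner_def integral_restrict_space)
next
  case False
  interpret periodic_cell a b i by unfold_locales (use i False in auto)
  let ?Q = "box a b"
  have main: "\<exists>W G. translation_derivative W G \<and> (AE x in lebesgue_on ?Q. w x = W x) \<and>
      (AE x in lebesgue_on ?Q. weak_partial ?Q i w x = G x)"
    if w: "w \<in> H1 ?Q" "periodic_traces a b w" for w
  proof -
    have L2: "w \<in> L2 ?Q" "weak_partial ?Q i w \<in> L2 ?Q"
      using w weak_partial_L2[OF _ i] by (auto simp: H1_def)
    obtain W where W: "sq W" "AE x in lebesgue_on ?Q. w x = W x"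
      using L2_periodic_representative[OF L2(1)] .
    obtain G where G: "sq G" "AE x in lebesgue_on ?Q. weak_partial ?Q i w x = G x"
      using L2_periodic_representative[OF L2(2)] .
    have "translation_derivative W G"
    proof (rule weak_periodic_imp_translation_derivative[OF W(1) G(1)])
      fix \<psi> :: "'a \<Rightarrow> real" assume \<psi>: "smooth \<psi>" "box_periodic a b \<psi>"
      let ?d = "\<lambda>x. frechet_derivative \<psi> (at x) i"
      note per = box_periodic_imp_periodic[OF \<psi>(2)]
      have "?d (x + L *\<^sub>R i) = ?d x" for x
        using frechet_derivative_translate[of \<psi> x "L *\<^sub>R i", OF smooth_differentiable[OF \<psi>(1)]] periodicD[OF per]
        by simp
      then have sqd: "sq ?d"
        by (intro smooth_periodic_sq smooth_frechet \<psi> i) (simp add: periodic_def shift_def fun_eq_iff)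
      have sq\<psi>: "sq \<psi>" by (rule smooth_periodic_sq[OF \<psi>(1) per])
      have "ip W ?d = l2_inner ?Q w ?d"
        using l2_inner_cong_AE[OF L2(1) sq_in_L2[OF W(1)] sq_in_L2[OF sqd] W(2)] l2_inner_eq_ip[OF W(1) sqd] by simp
      also have "\<dots> = - l2_inner ?Q (weak_partial ?Q i w) \<psi>"
        using w(2) i \<psi> by (simp add: periodic_traces_def)
      also have "l2_inner ?Q (weak_partial ?Q i w) \<psi> = ip G \<psi>"
        using l2_inner_cong_AE[OF L2(2) sq_in_L2[OF G(1)] sq_in_L2[OF sq\<psi>] G(2)] l2_inner_eq_ip[OF G(1) sq\<psi>] by simp
      finally show "ip W ?d = - ip G \<psi>" .
    qed
    with W G show ?thesis by blast
  qed
  obtain W G where W: "translation_derivative W G" "AE x in lebesgue_on ?Q. w x = W x"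
    "AE x in lebesgue_on ?Q. weak_partial ?Q i w x = G x" using main[OF w] by blast
  obtain V H where V: "translation_derivative V H" "AE x in lebesgue_on ?Q. v x = V x"
    "AE x in lebesgue_on ?Q. weak_partial ?Q i v x = H x" using main[OF v] by blast
  have sqs: "sq W" "sq G" "sq V" "sq H" using W(1) V(1) by (auto simp: translation_derivative_def)
  have inner: "l2_inner ?Q f g = ip P Q"
    if "f \<in> L2 ?Q" "g \<in> L2 ?Q" "sq P" "sq Q" "AE x in lebesgue_on ?Q. f x = P x" "AE x in lebesgue_on ?Q. g x = Q x"
    for f g P Q
  proof -
    have "l2_inner ?Q f g = l2_inner ?Q P g"
      by (rule l2_inner_cong_AE[OF that(1) sq_in_L2[OF that(3)] that(2,5)])
    also have "\<dots> = l2_inner ?Q g P" by (simp add: l2_inner_def mult.commute)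
    also have "\<dots> = l2_inner ?Q Q P"
      by (rule l2_inner_cong_AE[OF that(2) sq_in_L2[OF that(4)] sq_in_L2[OF that(3)] that(6)])
    also have "\<dots> = ip P Q" using that(3,4) by (simp add: l2_inner_eq_ip ip_commute[of Q])
    finally show ?thesis .
  qed
  have L2: "w \<in> L2 ?Q" "v \<in> L2 ?Q" "weak_partial ?Q i w \<in> L2 ?Q" "weak_partial ?Q i v \<in> L2 ?Q"
    using w v weak_partial_L2[OF _ i] by (auto simp: H1_def)
  show ?thesis
    using translation_derivative_skew[OF W(1) V(1)]
      inner[OF L2(3,2) sqs(2,3) W(3) V(2)] inner[OF L2(1,4) sqs(1,4) W(2) V(3)]
    by simp
qed

section \<open>Green's formula and the energy estimate\<close>

lemma green_periodic:
  assumes u: "u \<in> H2 (box a b)" "periodic_bc a b u" and v: "v \<in> H2 (box a b)" "periodic_bc a b v"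
  shows "l2_inner (box a b) (weak_laplacian (box a b) u) v
       = - l2_inner (box a b) (weak_grad (box a b) u) (weak_grad (box a b) v)"
proof -
  let ?Q = "box a b"
  let ?d = "\<lambda>i. weak_partial ?Q i"
  have H1: "u \<in> H1 ?Q" "v \<in> H1 ?Q" "\<And>i. i \<in> Basis \<Longrightarrow> ?d i u \<in> H1 ?Q"
    using u v by (auto simp: H2_def)
  have "v \<in> L2 ?Q" using H1(2) by (simp add: H1_def)
  then have "l2_inner ?Q (weak_laplacian ?Q u) v = (\<Sum>i\<in>Basis. l2_inner ?Q (?d i (?d i u)) v)"
    unfolding l2_inner_def weak_laplacian_def using H1(3)
    by (subst Bochner_Integration.integral_sum[symmetric])
       (auto simp: sum_distrib_right intro!: L2_mult_integrable weak_partial_L2)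
  also have "\<dots> = (\<Sum>i\<in>Basis. - l2_inner ?Q (?d i u) (?d i v))"
    using u v H1 by (intro sum.cong refl periodic_integration_by_parts) (auto simp: periodic_bc_def)
  also have "\<dots> = - l2_inner ?Q (weak_grad ?Q u) (weak_grad ?Q v)"
    unfolding l2_inner_def weak_grad_inner sum_negf using H1
    by (subst Bochner_Integration.integral_sum)
       (auto intro!: L2_mult_integrable weak_partial_L2)
  finally show ?thesis .
qed

lemma l2_norm_power2: "(l2_norm \<Omega> u)\<^sup>2 = l2_inner \<Omega> u u"
  unfolding l2_norm_def l2_inner_def
  by (subst real_sqrt_pow2) (auto intro!: Bochner_Integration.integral_nonneg)

lemma l2_inner_commute: "l2_inner \<Omega> u v = l2_inner \<Omega> v u"
  by (simp add: l2_inner_def inner_commute)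

lemma weak_grad_norm_linear:
  fixes u v :: "'a::euclidean_space \<Rightarrow> real"
  assumes \<Omega>: "open \<Omega>" "bounded \<Omega>" and uv: "u \<in> H1 \<Omega>" "v \<in> H1 \<Omega>"
  defines "A \<equiv> \<lambda>p q. l2_inner \<Omega> (weak_grad \<Omega> p) (weak_grad \<Omega> q)"
  shows "(l2_norm \<Omega> (weak_grad \<Omega> (\<lambda>x. c * u x + d * v x)))\<^sup>2 = c\<^sup>2 * A u u + 2 * c * d * A u v + d\<^sup>2 * A v v"
proof -
  let ?g = "weak_grad \<Omega>" and ?s = "\<lambda>x. c * u x + d * v x"
  have "(l2_norm \<Omega> (?g ?s))\<^sup>2 = (LINT x|lebesgue_on \<Omega>. ?g ?s x \<bullet> ?g ?s x)"
    by (simp only: l2_norm_power2) (simp add: l2_inner_def)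
  also have "\<dots> = (LINT x|lebesgue_on \<Omega>. c\<^sup>2 * (?g u x \<bullet> ?g u x) + 2 * c * d * (?g u x \<bullet> ?g v x) + d\<^sup>2 * (?g v x \<bullet> ?g v x))"
  proof (rule integral_cong_AE)
    show "(\<lambda>x. ?g ?s x \<bullet> ?g ?s x) \<in> borel_measurable (lebesgue_on \<Omega>)"
      using weak_grad_inner_integrable[OF H1_linear[OF \<Omega> uv] H1_linear[OF \<Omega> uv]] by simp
    show "AE x in lebesgue_on \<Omega>. ?g ?s x \<bullet> ?g ?s x
        = c\<^sup>2 * (?g u x \<bullet> ?g u x) + 2 * c * d * (?g u x \<bullet> ?g v x) + d\<^sup>2 * (?g v x \<bullet> ?g v x)"
      using weak_grad_linear[OF \<Omega> uv, of c d]
      by eventually_elim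
         (simp add: inner_add_left inner_add_right inner_commute power2_eq_square algebra_simps)
  qed (use uv in \<open>intro borel_measurable_integrable Bochner_Integration.integrable_add
      integrable_mult_right weak_grad_inner_integrable\<close>)
  also have "\<dots> = c\<^sup>2 * A u u + 2 * c * d * A u v + d\<^sup>2 * A v v"
    using weak_grad_inner_integrable[OF uv(1) uv(1)] weak_grad_inner_integrable[OF uv]
      weak_grad_inner_integrable[OF uv(2) uv(2)]
    by (simp add: A_def l2_inner_def)
  finally show ?thesis .
qed

text \<open>One time step, with \<open>u\<close>, \<open>v\<close>, \<open>w\<close> the new, current and previous iterate, \<open>r\<close> the step ratio and \<open>k\<close> the sum of the
nonlinear and history terms. Testing the first equation with the increment \<open>\<delta> = u - v\<close> and multiplying the second by
\<open>R1 + R0\<close> makes all terms with \<open>k\<close> cancel. The left-hand side of the claim is then exactly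
\<open>- \<beta> / \<tau> * D - \<theta>\<^sup>2 / 4 * S\<close>, where \<open>D\<close> is the squared norm of \<open>\<delta>\<close> and \<open>S\<close> the squared norm of the gradient of
\<open>(u - v) - r * (v - w)\<close>.\<close>

lemma scheme_energy_step:
  fixes \<Omega> :: "'a::euclidean_space set" and u v w k :: "'a \<Rightarrow> real"
  assumes \<Omega>: "open \<Omega>" "bounded \<Omega>"
    and H2: "u \<in> H2 \<Omega>" "v \<in> H2 \<Omega>" "w \<in> H2 \<Omega>" and k: "k \<in> L2 \<Omega>"
    and green: "\<And>p q. p \<in> {u, v, w} \<Longrightarrow> q \<in> {u, v, w} \<Longrightarrow>
      l2_inner \<Omega> (weak_laplacian \<Omega> p) q = - l2_inner \<Omega> (weak_grad \<Omega> p) (weak_grad \<Omega> q)"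
    and pos: "0 \<le> \<beta>" "0 < \<tau>"
    and c: "c = (R1 + R0) / (2 * Rh)"
    and eqn: "AE x in lebesgue_on \<Omega>. \<beta> * ((u x - v x) / \<tau>)
      - \<epsilon>\<^sup>2 * (weak_laplacian \<Omega> (\<lambda>y. u y + v y) x / 2)
      + (1 - c) * \<theta>\<^sup>2 * weak_laplacian \<Omega> (\<lambda>y. v y + r / 2 * (v y - w y)) x + c * k x = 0"
    and eqn_R: "(R1 - R0) / \<tau> = 1 / (2 * Rh) *
      l2_inner \<Omega> (\<lambda>x. - \<theta>\<^sup>2 * weak_laplacian \<Omega> (\<lambda>y. v y + r / 2 * (v y - w y)) x + k x) (\<lambda>x. (u x - v x) / \<tau>)"
  shows "(\<epsilon>\<^sup>2 - \<theta>\<^sup>2) / 2 * (l2_norm \<Omega> (weak_grad \<Omega> u))\<^sup>2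
        + \<theta>\<^sup>2 / 4 * (l2_norm \<Omega> (weak_grad \<Omega> (\<lambda>x. u x - v x)))\<^sup>2 + \<bar>R1\<bar>\<^sup>2
      - ((\<epsilon>\<^sup>2 - \<theta>\<^sup>2) / 2 * (l2_norm \<Omega> (weak_grad \<Omega> v))\<^sup>2
        + \<theta>\<^sup>2 / 4 * r\<^sup>2 * (l2_norm \<Omega> (weak_grad \<Omega> (\<lambda>x. v x - w x)))\<^sup>2 + \<bar>R0\<bar>\<^sup>2) \<le> 0"
proof -
  let ?M = "lebesgue_on \<Omega>" and ?lap = "weak_laplacian \<Omega>"
  define A where "A p q = l2_inner \<Omega> (weak_grad \<Omega> p) (weak_grad \<Omega> q)" for p q
  have A_commute: "A p q = A q p" for p q by (simp add: A_def l2_inner_commute)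
  define \<delta> where "\<delta> x = u x - v x" for x
  define X where "X p = l2_inner \<Omega> (?lap p) \<delta>" for p
  define Y where "Y = (1 + r / 2) * X v - r / 2 * X w"
  define K where "K = l2_inner \<Omega> k \<delta>"
  define D where "D = l2_inner \<Omega> \<delta> \<delta>"
  have H1: "u \<in> H1 \<Omega>" "v \<in> H1 \<Omega>" "w \<in> H1 \<Omega>" using H2 by (auto simp: H2_def)
  then have L2: "u \<in> L2 \<Omega>" "v \<in> L2 \<Omega>" by (auto simp: H1_def)
  have lap: "?lap u \<in> L2 \<Omega>" "?lap v \<in> L2 \<Omega>" "?lap w \<in> L2 \<Omega>" using H2 weak_laplacian_L2 by auto
  have \<delta>: "\<delta> \<in> L2 \<Omega>" using L2_linear[OF L2, of 1 "-1"] by (simp add: \<delta>_def[abs_def])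
  note int = L2_mult_integrable[OF lap(1) \<delta>] L2_mult_integrable[OF lap(2) \<delta>] L2_mult_integrable[OF lap(3) \<delta>]
    L2_mult_integrable[OF k \<delta>] L2_mult_integrable[OF \<delta> \<delta>]
  have X: "X p = A p v - A p u" if "p \<in> {u, v, w}" for p
  proof -
    have p: "?lap p \<in> L2 \<Omega>" using that lap by auto
    have "X p = l2_inner \<Omega> (\<lambda>x. 1 * u x + (-1) * v x) (?lap p)"
      by (simp add: X_def l2_inner_commute[of _ "?lap p"] \<delta>_def[abs_def])
    also have "\<dots> = l2_inner \<Omega> (?lap p) u - l2_inner \<Omega> (?lap p) v"
      unfolding l2_inner_linear_left[OF L2 p] by (simp add: l2_inner_commute)
    finally show ?thesis using green[OF that] by (simp add: A_def)
  qed
  have half: "(\<lambda>y. v y + r / 2 * (v y - w y)) = (\<lambda>y. (1 + r / 2) * v y + (- r / 2) * w y)"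
    by (simp add: fun_eq_iff field_simps)
  have lap_half: "AE x in ?M. ?lap (\<lambda>y. v y + r / 2 * (v y - w y)) x = (1 + r / 2) * ?lap v x + (- r / 2) * ?lap w x"
    unfolding half by (rule weak_laplacian_linear[OF \<Omega> H2(2,3)])
  have lap_sum: "AE x in ?M. ?lap (\<lambda>y. u y + v y) x = ?lap u x + ?lap v x"
    using weak_laplacian_linear[OF \<Omega> H2(1,2), of 1 1] by simp
  have half_H2: "(\<lambda>y. v y + r / 2 * (v y - w y)) \<in> H2 \<Omega>"
    unfolding half by (rule H2_linear[OF \<Omega> H2(2,3)])
  have "AE x in ?M. \<beta> / \<tau> * (\<delta> x * \<delta> x) - \<epsilon>\<^sup>2 / 2 * (?lap u x * \<delta> x + ?lap v x * \<delta> x)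
      + (1 - c) * \<theta>\<^sup>2 * ((1 + r / 2) * (?lap v x * \<delta> x) - r / 2 * (?lap w x * \<delta> x)) + c * (k x * \<delta> x) = 0"
    using eqn lap_half lap_sum
  proof eventually_elim
    case (elim x)
    have "\<beta> / \<tau> * (\<delta> x * \<delta> x) - \<epsilon>\<^sup>2 / 2 * (?lap u x * \<delta> x + ?lap v x * \<delta> x)
      + (1 - c) * \<theta>\<^sup>2 * ((1 + r / 2) * (?lap v x * \<delta> x) - r / 2 * (?lap w x * \<delta> x)) + c * (k x * \<delta> x)
      = (\<beta> * (\<delta> x / \<tau>) - \<epsilon>\<^sup>2 * ((?lap u x + ?lap v x) / 2)
        + (1 - c) * \<theta>\<^sup>2 * ((1 + r / 2) * ?lap v x + (- r / 2) * ?lap w x) + c * k x) * \<delta> x"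
      by (simp add: field_simps)
    also have "\<dots> = 0" using elim by (simp add: \<delta>_def)
    finally show ?case .
  qed
  then have "(LINT x|?M. \<beta> / \<tau> * (\<delta> x * \<delta> x) - \<epsilon>\<^sup>2 / 2 * (?lap u x * \<delta> x + ?lap v x * \<delta> x)
      + (1 - c) * \<theta>\<^sup>2 * ((1 + r / 2) * (?lap v x * \<delta> x) - r / 2 * (?lap w x * \<delta> x)) + c * (k x * \<delta> x)) = 0"
    by (rule integral_eq_zero_AE)
  then have tested: "\<beta> / \<tau> * D - \<epsilon>\<^sup>2 / 2 * (X u + X v) + (1 - c) * \<theta>\<^sup>2 * Y + c * K = 0"
    using int by (simp add: X_def Y_def K_def D_def l2_inner_def)
  have "l2_inner \<Omega> (\<lambda>x. - \<theta>\<^sup>2 * ?lap (\<lambda>y. v y + r / 2 * (v y - w y)) x + k x) (\<lambda>x. (u x - v x) / \<tau>)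
      = (1 / \<tau>) * l2_inner \<Omega> (\<lambda>x. - \<theta>\<^sup>2 * ?lap (\<lambda>y. v y + r / 2 * (v y - w y)) x + 1 * k x) \<delta>"
    by (simp add: l2_inner_def \<delta>_def)
  also have "l2_inner \<Omega> (\<lambda>x. - \<theta>\<^sup>2 * ?lap (\<lambda>y. v y + r / 2 * (v y - w y)) x + 1 * k x) \<delta>
      = - \<theta>\<^sup>2 * l2_inner \<Omega> (?lap (\<lambda>y. v y + r / 2 * (v y - w y))) \<delta> + 1 * K"
    unfolding K_def by (rule l2_inner_linear_left[OF weak_laplacian_L2[OF half_H2] k \<delta>])
  also have "l2_inner \<Omega> (?lap (\<lambda>y. v y + r / 2 * (v y - w y))) \<delta>
      = l2_inner \<Omega> (\<lambda>x. (1 + r / 2) * ?lap v x + (- r / 2) * ?lap w x) \<delta>"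
    by (rule l2_inner_cong_AE[OF weak_laplacian_L2[OF half_H2] L2_linear[OF lap(2,3)] \<delta> lap_half])
  also have "\<dots> = Y"
    unfolding l2_inner_linear_left[OF lap(2,3) \<delta>] by (simp add: Y_def X_def)
  finally have "(R1 - R0) / \<tau> = 1 / (2 * Rh) * (1 / \<tau> * (- \<theta>\<^sup>2 * Y + 1 * K))"
    using eqn_R by simp
  then have "(R1 - R0) / \<tau> = (1 / (2 * Rh) * (- \<theta>\<^sup>2 * Y + K)) / \<tau>" by simp
  then have "R1 - R0 = 1 / (2 * Rh) * (- \<theta>\<^sup>2 * Y + K)"
    unfolding divide_cancel_right using pos(2) by simp
  then have "(R1 + R0) * (R1 - R0) = c * (- \<theta>\<^sup>2 * Y + K)" by (simp add: c)
  moreover have "(R1 + R0) * (R1 - R0) = \<bar>R1\<bar>\<^sup>2 - \<bar>R0\<bar>\<^sup>2"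
    by (simp add: power2_eq_square algebra_simps)
  moreover have "c * (- \<theta>\<^sup>2 * Y + K) = c * K - c * (\<theta>\<^sup>2 * Y)"
    and "(1 - c) * \<theta>\<^sup>2 * Y = \<theta>\<^sup>2 * Y - c * (\<theta>\<^sup>2 * Y)"
    by (simp_all add: algebra_simps)
  ultimately have R: "\<bar>R1\<bar>\<^sup>2 - \<bar>R0\<bar>\<^sup>2 = - (\<beta> / \<tau> * D) + \<epsilon>\<^sup>2 / 2 * (X u + X v) - \<theta>\<^sup>2 * Y"
    using tested by linarith
  have XY: "X u + X v = A v v - A u u" "Y = (1 + r / 2) * (A v v - A u v) - r / 2 * (A v w - A u w)"
    unfolding Y_def by (auto simp: X A_commute)
  have norms: "(l2_norm \<Omega> (weak_grad \<Omega> u))\<^sup>2 = A u u" "(l2_norm \<Omega> (weak_grad \<Omega> v))\<^sup>2 = A v v"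
    "(l2_norm \<Omega> (weak_grad \<Omega> (\<lambda>x. u x - v x)))\<^sup>2 = A u u - 2 * A u v + A v v"
    "(l2_norm \<Omega> (weak_grad \<Omega> (\<lambda>x. v x - w x)))\<^sup>2 = A v v - 2 * A v w + A w w"
    using weak_grad_norm_linear[OF \<Omega> H1(1,2), of 1 "-1"] weak_grad_norm_linear[OF \<Omega> H1(2,3), of 1 "-1"]
    by (simp_all add: l2_norm_power2 A_def)
  \<comment> \<open>The complete square: Young's inequality for the extrapolation term, with its remainder kept.\<close>
  define S where "S = (LINT x|?M. (norm (weak_grad \<Omega> u x - (1 + r) *\<^sub>R weak_grad \<Omega> v x + r *\<^sub>R weak_grad \<Omega> w x))\<^sup>2)"
  have S: "0 \<le> S" unfolding S_def by (rule Bochner_Integration.integral_nonneg) simp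
  let ?g = "weak_grad \<Omega>"
  note gint = weak_grad_inner_integrable[OF H1(1) H1(1)] weak_grad_inner_integrable[OF H1(1) H1(2)]
    weak_grad_inner_integrable[OF H1(1) H1(3)] weak_grad_inner_integrable[OF H1(2) H1(2)]
    weak_grad_inner_integrable[OF H1(2) H1(3)] weak_grad_inner_integrable[OF H1(3) H1(3)]
  have "S = (LINT x|?M. ?g u x \<bullet> ?g u x - 2 * (1 + r) * (?g u x \<bullet> ?g v x) + 2 * r * (?g u x \<bullet> ?g w x)
      + (1 + r)\<^sup>2 * (?g v x \<bullet> ?g v x) - 2 * r * (1 + r) * (?g v x \<bullet> ?g w x) + r\<^sup>2 * (?g w x \<bullet> ?g w x))"
    unfolding S_def power2_norm_eq_inner
    by (intro Bochner_Integration.integral_cong refl)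
       (simp add: inner_add_left inner_add_right inner_diff_left inner_diff_right inner_commute power2_eq_square algebra_simps)
  also have "\<dots> = A u u - 2 * (1 + r) * A u v + 2 * r * A u w + (1 + r)\<^sup>2 * A v v - 2 * r * (1 + r) * A v w + r\<^sup>2 * A w w"
    using gint by (simp add: A_def l2_inner_def)
  finally have S_eq: "S = A u u - 2 * (1 + r) * A u v + 2 * r * A u w + (1 + r)\<^sup>2 * A v v - 2 * r * (1 + r) * A v w + r\<^sup>2 * A w w" .
  have "(\<epsilon>\<^sup>2 - \<theta>\<^sup>2) / 2 * A u u + \<theta>\<^sup>2 / 4 * (A u u - 2 * A u v + A v v) + \<bar>R1\<bar>\<^sup>2
      - ((\<epsilon>\<^sup>2 - \<theta>\<^sup>2) / 2 * A v v + \<theta>\<^sup>2 / 4 * r\<^sup>2 * (A v v - 2 * A v w + A w w) + \<bar>R0\<bar>\<^sup>2)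
    = (\<epsilon>\<^sup>2 - \<theta>\<^sup>2) / 2 * (A u u - A v v) + \<theta>\<^sup>2 / 4 * (A u u - 2 * A u v + A v v)
      - \<theta>\<^sup>2 / 4 * r\<^sup>2 * (A v v - 2 * A v w + A w w) + (\<bar>R1\<bar>\<^sup>2 - \<bar>R0\<bar>\<^sup>2)"
    by (simp add: right_diff_distrib)
  also have "\<dots> = - (\<beta> / \<tau> * D) - \<theta>\<^sup>2 / 4 * S"
    unfolding R XY S_eq by (simp add: algebra_simps power2_eq_square add_divide_distrib diff_divide_distrib)
  also have "\<dots> \<le> 0"
  proof -
    have "0 \<le> D" unfolding D_def l2_inner_def by (rule Bochner_Integration.integral_nonneg) simp
    then have "0 \<le> \<beta> / \<tau> * D" using pos by simp
    moreover have "0 \<le> \<theta>\<^sup>2 / 4 * S" using S by simp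
    ultimately show ?thesis by linarith
  qed
  finally show ?thesis unfolding norms .
qed

lemma antimono_on_int_interval:
  fixes E :: "int \<Rightarrow> real"
  assumes "\<And>n. n \<in> {0..<m} \<Longrightarrow> E (n + 1) \<le> E n"
  shows "antimono_on {0..m} E"
proof (rule monotone_onI)
  fix x y :: int assume xy: "x \<in> {0..m}" "y \<in> {0..m}" "x \<le> y"
  from xy(3,2) show "E y \<le> E x"
  proof (induction y rule: int_ge_induct)
    case (step y)
    with xy(1) assms[of y] show ?case by auto
  qed simp
qed

theorem theorem4p1:
  fixes \<Omega> :: "'a::euclidean_space set"
    and F :: "real \<Rightarrow> real"
    and \<alpha> \<epsilon> \<theta> T :: real
    and M :: int
    and t \<tau> R :: "int \<Rightarrow> real"
    and \<phi> :: "int \<Rightarrow> 'a \<Rightarrow> real"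
  assumes dim: "DIM('a) \<in> {1, 2, 3}"
    and domain: "open \<Omega>" "connected \<Omega>" "bounded \<Omega>" "\<Omega> \<noteq> {}"
    and F_diff: "\<And>z. F differentiable (at z)"
    and alpha: "0 < \<alpha>" "\<alpha> < 1"
    and theta: "\<theta>\<^sup>2 \<le> \<epsilon>\<^sup>2"
    and mesh: "1 \<le> M" "t 0 = 0" "strict_mono_on {0..M} t" "t M = T"
    and steps: "\<And>n. n \<in> {1..M} \<Longrightarrow> \<tau> n = t n - t (n - 1)" "0 < \<tau> 0"
    and regularity: "\<And>n. n \<in> {-1..M} \<Longrightarrow> \<phi> n \<in> H2 \<Omega>"
      "\<And>n. n \<in> {0..<M} \<Longrightarrow> (\<lambda>x. deriv F (extrapolate_fun \<tau> \<phi> n x)) \<in> L2 \<Omega>"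
    and boundary: "(\<exists>a b. \<Omega> = box a b \<and> (\<forall>n\<in>{-1..M}. periodic_bc a b (\<phi> n))) \<or>
      (\<forall>n\<in>{-1..M}. neumann_bc \<Omega> (\<phi> n))"
    and R_nonzero: "\<And>n. n \<in> {0..<M} \<Longrightarrow> extrapolate \<tau> R n \<noteq> 0"
    and scheme_phi: "\<And>n. n \<in> {0..<M} \<Longrightarrow> AE x in lebesgue_on \<Omega>.
      L1CN_local \<alpha> t \<tau> \<phi> n x
      - \<epsilon>\<^sup>2 * (weak_laplacian \<Omega> (\<lambda>y. \<phi> (n + 1) y + \<phi> n y) x / 2)
      + (1 - (R (n + 1) + R n) / (2 * extrapolate \<tau> R n)) * \<theta>\<^sup>2
          * weak_laplacian \<Omega> (extrapolate_fun \<tau> \<phi> n) x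
      + (R (n + 1) + R n) / (2 * extrapolate \<tau> R n)
          * (deriv F (extrapolate_fun \<tau> \<phi> n x) + L1CN_history \<alpha> t \<tau> \<phi> n x) = 0"
    and scheme_R: "\<And>n. n \<in> {0..<M} \<Longrightarrow>
      (R (n + 1) - R n) / \<tau> (n + 1) =
        1 / (2 * extrapolate \<tau> R n) *
        l2_inner \<Omega>
          (\<lambda>x. - \<theta>\<^sup>2 * weak_laplacian \<Omega> (extrapolate_fun \<tau> \<phi> n) x
                + deriv F (extrapolate_fun \<tau> \<phi> n x) + L1CN_history \<alpha> t \<tau> \<phi> n x)
          (\<lambda>x. (\<phi> (n + 1) x - \<phi> n x) / \<tau> (n + 1))"
  shows "(\<forall>n\<in>{0..<M}.
        (\<epsilon>\<^sup>2 - \<theta>\<^sup>2) / 2 * (l2_norm \<Omega> (weak_grad \<Omega> (\<phi> (n + 1))))\<^sup>2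
        + \<theta>\<^sup>2 / 4 * (l2_norm \<Omega> (weak_grad \<Omega> (\<lambda>x. \<phi> (n + 1) x - \<phi> n x)))\<^sup>2
        + \<bar>R (n + 1)\<bar>\<^sup>2
        - ((\<epsilon>\<^sup>2 - \<theta>\<^sup>2) / 2 * (l2_norm \<Omega> (weak_grad \<Omega> (\<phi> n)))\<^sup>2
           + \<theta>\<^sup>2 / 4 * (\<tau> (n + 1) / \<tau> n)\<^sup>2
               * (l2_norm \<Omega> (weak_grad \<Omega> (\<lambda>x. \<phi> n x - \<phi> (n - 1) x)))\<^sup>2
           + \<bar>R n\<bar>\<^sup>2) \<le> 0)
    \<and> ((\<forall>n\<in>{0..<M}. \<tau> (n + 1) / \<tau> n = 1) \<longrightarrow>
        antimono_on {0..M} (\<lambda>n.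
          (\<epsilon>\<^sup>2 - \<theta>\<^sup>2) / 2 * (l2_norm \<Omega> (weak_grad \<Omega> (\<phi> n)))\<^sup>2
          + \<theta>\<^sup>2 / 4 * (l2_norm \<Omega> (weak_grad \<Omega> (\<lambda>x. \<phi> n x - \<phi> (n - 1) x)))\<^sup>2
          + \<bar>R n\<bar>\<^sup>2))
    \<and> (\<theta> = 0 \<longrightarrow>
        antimono_on {0..M} (\<lambda>n.
          \<epsilon>\<^sup>2 / 2 * (l2_norm \<Omega> (weak_grad \<Omega> (\<phi> n)))\<^sup>2 + \<bar>R n\<bar>\<^sup>2))"
proof -
  have \<Omega>: "open \<Omega>" "bounded \<Omega>" using domain by auto
  have \<tau>_pos: "0 < \<tau> n" if "n \<in> {0..M}" for n
  proof (cases "n = 0")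
    case False
    with that have "t (n - 1) < t n" by (intro strict_mono_onD[OF mesh(3)]) auto
    with False that show ?thesis by (simp add: steps(1))
  qed (simp add: steps(2))
  have green: "l2_inner \<Omega> (weak_laplacian \<Omega> (\<phi> m)) (\<phi> k) = - l2_inner \<Omega> (weak_grad \<Omega> (\<phi> m)) (weak_grad \<Omega> (\<phi> k))"
    if "m \<in> {-1..M}" "k \<in> {-1..M}" for m k
    using boundary
  proof (elim disjE exE conjE)
    fix a b assume "\<Omega> = box a b" "\<forall>n\<in>{-1..M}. periodic_bc a b (\<phi> n)"
    then show ?thesis using green_periodic[of "\<phi> m" a b "\<phi> k"] that regularity(1) by simp
  next
    assume "\<forall>n\<in>{-1..M}. neumann_bc \<Omega> (\<phi> n)"
    moreover have "\<phi> k \<in> H1 \<Omega>" using regularity(1)[OF that(2)] by (simp add: H2_def)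
    ultimately show ?thesis using that(1) by (simp add: neumann_bc_def)
  qed
  have \<phi>_L2: "\<phi> k \<in> L2 \<Omega>" if "k \<in> {-1..M}" for k
    using regularity(1)[OF that] by (simp add: H2_def H1_def)
  have step: "(\<epsilon>\<^sup>2 - \<theta>\<^sup>2) / 2 * (l2_norm \<Omega> (weak_grad \<Omega> (\<phi> (n + 1))))\<^sup>2
        + \<theta>\<^sup>2 / 4 * (l2_norm \<Omega> (weak_grad \<Omega> (\<lambda>x. \<phi> (n + 1) x - \<phi> n x)))\<^sup>2
        + \<bar>R (n + 1)\<bar>\<^sup>2
        - ((\<epsilon>\<^sup>2 - \<theta>\<^sup>2) / 2 * (l2_norm \<Omega> (weak_grad \<Omega> (\<phi> n)))\<^sup>2
           + \<theta>\<^sup>2 / 4 * (\<tau> (n + 1) / \<tau> n)\<^sup>2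
               * (l2_norm \<Omega> (weak_grad \<Omega> (\<lambda>x. \<phi> n x - \<phi> (n - 1) x)))\<^sup>2
           + \<bar>R n\<bar>\<^sup>2) \<le> 0" if n: "n \<in> {0..<M}" for n
  proof (rule scheme_energy_step[OF \<Omega>])
    let ?k = "\<lambda>x. deriv F (extrapolate_fun \<tau> \<phi> n x) + L1CN_history \<alpha> t \<tau> \<phi> n x"
    have half: "extrapolate_fun \<tau> \<phi> n = (\<lambda>y. \<phi> n y + \<tau> (n + 1) / \<tau> n / 2 * (\<phi> n y - \<phi> (n - 1) y))"
      by (simp add: fun_eq_iff extrapolate_fun_def extrapolate_def mult.commute)
    show "\<phi> (n + 1) \<in> H2 \<Omega>" "\<phi> n \<in> H2 \<Omega>" "\<phi> (n - 1) \<in> H2 \<Omega>"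
      using n by (auto intro!: regularity(1))
    have "L1CN_history \<alpha> t \<tau> \<phi> n \<in> L2 \<Omega>"
      unfolding L1CN_history_def[abs_def]
    proof (rule L2_sum)
      fix k assume "k \<in> {0..<n}"
      then have "(\<lambda>x. L1CN_coeff \<alpha> t n (n - k) / \<tau> (k + 1) * \<phi> (k + 1) x
          + (- L1CN_coeff \<alpha> t n (n - k) / \<tau> (k + 1)) * \<phi> k x) \<in> L2 \<Omega>"
        using n by (intro L2_linear \<phi>_L2) auto
      then show "(\<lambda>x. L1CN_coeff \<alpha> t n (n - k) * ((\<phi> (k + 1) x - \<phi> k x) / \<tau> (k + 1))) \<in> L2 \<Omega>"
        by (simp add: diff_divide_distrib right_diff_distrib)
    qed
    then show "?k \<in> L2 \<Omega>"
      using L2_linear[OF regularity(2)[OF n], of "L1CN_history \<alpha> t \<tau> \<phi> n" 1 1] by simp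
    show "l2_inner \<Omega> (weak_laplacian \<Omega> p) q = - l2_inner \<Omega> (weak_grad \<Omega> p) (weak_grad \<Omega> q)"
      if "p \<in> {\<phi> (n + 1), \<phi> n, \<phi> (n - 1)}" "q \<in> {\<phi> (n + 1), \<phi> n, \<phi> (n - 1)}" for p q
      using that n by (auto intro!: green)
    show "0 \<le> L1CN_coeff \<alpha> t n 0"
      using alpha Gamma_real_pos[of "2 - \<alpha>"] by (simp add: L1CN_coeff_def)
    show "0 < \<tau> (n + 1)" using n by (intro \<tau>_pos) auto
    show "(R (n + 1) + R n) / (2 * extrapolate \<tau> R n) = (R (n + 1) + R n) / (2 * extrapolate \<tau> R n)" ..
    show "AE x in lebesgue_on \<Omega>. L1CN_coeff \<alpha> t n 0 * ((\<phi> (n + 1) x - \<phi> n x) / \<tau> (n + 1))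
      - \<epsilon>\<^sup>2 * (weak_laplacian \<Omega> (\<lambda>y. \<phi> (n + 1) y + \<phi> n y) x / 2)
      + (1 - (R (n + 1) + R n) / (2 * extrapolate \<tau> R n)) * \<theta>\<^sup>2
          * weak_laplacian \<Omega> (\<lambda>y. \<phi> n y + \<tau> (n + 1) / \<tau> n / 2 * (\<phi> n y - \<phi> (n - 1) y)) x
      + (R (n + 1) + R n) / (2 * extrapolate \<tau> R n) * ?k x = 0"
      using scheme_phi[OF n] unfolding half L1CN_local_def .
    show "(R (n + 1) - R n) / \<tau> (n + 1) = 1 / (2 * extrapolate \<tau> R n) *
      l2_inner \<Omega> (\<lambda>x. - \<theta>\<^sup>2 * weak_laplacian \<Omega> (\<lambda>y. \<phi> n y + \<tau> (n + 1) / \<tau> n / 2 * (\<phi> n y - \<phi> (n - 1) y)) x + ?k x)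
        (\<lambda>x. (\<phi> (n + 1) x - \<phi> n x) / \<tau> (n + 1))"
      using scheme_R[OF n] unfolding half add.assoc .
  qed
  show ?thesis
  proof (intro conjI impI ballI)
    fix n assume "n \<in> {0..<M}"
    then show "(\<epsilon>\<^sup>2 - \<theta>\<^sup>2) / 2 * (l2_norm \<Omega> (weak_grad \<Omega> (\<phi> (n + 1))))\<^sup>2
        + \<theta>\<^sup>2 / 4 * (l2_norm \<Omega> (weak_grad \<Omega> (\<lambda>x. \<phi> (n + 1) x - \<phi> n x)))\<^sup>2
        + \<bar>R (n + 1)\<bar>\<^sup>2
        - ((\<epsilon>\<^sup>2 - \<theta>\<^sup>2) / 2 * (l2_norm \<Omega> (weak_grad \<Omega> (\<phi> n)))\<^sup>2
           + \<theta>\<^sup>2 / 4 * (\<tau> (n + 1) / \<tau> n)\<^sup>2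
               * (l2_norm \<Omega> (weak_grad \<Omega> (\<lambda>x. \<phi> n x - \<phi> (n - 1) x)))\<^sup>2
           + \<bar>R n\<bar>\<^sup>2) \<le> 0" by (rule step)
  next
    assume uniform: "\<forall>n\<in>{0..<M}. \<tau> (n + 1) / \<tau> n = 1"
    show "antimono_on {0..M} (\<lambda>n.
          (\<epsilon>\<^sup>2 - \<theta>\<^sup>2) / 2 * (l2_norm \<Omega> (weak_grad \<Omega> (\<phi> n)))\<^sup>2
          + \<theta>\<^sup>2 / 4 * (l2_norm \<Omega> (weak_grad \<Omega> (\<lambda>x. \<phi> n x - \<phi> (n - 1) x)))\<^sup>2
          + \<bar>R n\<bar>\<^sup>2)"
    proof (rule antimono_on_int_interval)
      fix n assume n: "n \<in> {0..<M}"
      have ratio: "\<tau> (n + 1) / \<tau> n = 1" using uniform n by blast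
      show "(\<epsilon>\<^sup>2 - \<theta>\<^sup>2) / 2 * (l2_norm \<Omega> (weak_grad \<Omega> (\<phi> (n + 1))))\<^sup>2
          + \<theta>\<^sup>2 / 4 * (l2_norm \<Omega> (weak_grad \<Omega> (\<lambda>x. \<phi> (n + 1) x - \<phi> (n + 1 - 1) x)))\<^sup>2
          + \<bar>R (n + 1)\<bar>\<^sup>2
        \<le> (\<epsilon>\<^sup>2 - \<theta>\<^sup>2) / 2 * (l2_norm \<Omega> (weak_grad \<Omega> (\<phi> n)))\<^sup>2
          + \<theta>\<^sup>2 / 4 * (l2_norm \<Omega> (weak_grad \<Omega> (\<lambda>x. \<phi> n x - \<phi> (n - 1) x)))\<^sup>2
          + \<bar>R n\<bar>\<^sup>2"
        using step[OF n] unfolding ratio by simp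
    qed
  next
    assume "\<theta> = 0"
    then show "antimono_on {0..M} (\<lambda>n.
          \<epsilon>\<^sup>2 / 2 * (l2_norm \<Omega> (weak_grad \<Omega> (\<phi> n)))\<^sup>2 + \<bar>R n\<bar>\<^sup>2)"
      using step by (intro antimono_on_int_interval) simp
  qed
qed

end
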